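(* Under the standing assumption, let $J_{\mathcal P_I}$ be the optimal value of Primal Problem I, $$J_{\mathcal P_I}=\inf\Big\{\mathrm{Tr}\big(\mathrm{diag}(\Lambda+\bar\Lambda,\Lambda)\tilde S\big)\;:\;\tilde S\in\mathcal S_{2n+2m},\ (F,\bar F)\in\mathcal F,\ \mathbf D^*_{F,\bar F}(\tilde S)+\mathbb F_1Z_2\mathbb F_1'+\mathbb F_2(Z_1-Z_2)\mathbb F_2'=\tilde S\Big\},$$ and let $J_{\mathcal D}$ be the value of the dual problem, $$J_{\mathcal D}=\sup_{\tilde{\mathfrak X}\in\mathcal S_{2n+2m}}\ \inf_{\tilde S\in\mathcal S_{2n+2m}^+,\ (F,\bar F)\in\mathcal F}L(\tilde{\mathfrak X},F,\bar F,\tilde S),$$ where $$L(\tilde{\mathfrak X},F,\bar F,\tilde S)=\mathrm{Tr}\big(\mathrm{diag}(\Lambda+\bar\Lambda,\Lambda)\tilde S\big)+\mathrm{Tr}\Big\{\big(\mathbf D^*_{F,\bar F}(\tilde S)-\tilde S+\mathbb F_1Z_2\mathbb F_1'+\mathbb F_2(Z_1-Z_2)\mathbb F_2'\big)\tilde{\mathfrak X}\Big\}.$$ Then strong duality holds: $J_{\mathcal D}=J_{\mathcal P_I}$.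
   Context: Notation: $'$ is transpose; $\mathcal S_k$, $\mathcal S_k^+$ are the real symmetric, resp. symmetric positive semidefinite, $k\times k$ matrices; $>0$ / $\ge 0$ denote positive (semi)definiteness; $\mathrm{diag}$ is block diagonal. System. $A_1,\bar A_1,A_2,\bar A_2\in\mathbb R^{n\times n}$, $B_1,\bar B_1,B_2,\bar B_2\in\mathbb R^{n\times m}$, $Q,\bar Q\in\mathcal S_n$, $R,\bar R\in\mathcal S_m$. Put $\hat A_i=A_i+\bar A_i$, $\hat B_i=B_i+\bar B_i$ ($i=1,2$), $\hat Q=Q+\bar Q$, $\hat R=R+\bar R$, $\Lambda=\mathrm{diag}(Q,R)$, $\bar\Lambda=\mathrm{diag}(\bar Q,\bar R)$. The mean-field stochastic system is $$x_{k+1}=(A_1x_k+\bar A_1\mathbb Ex_k+B_1u_k+\bar B_1\mathbb Eu_k)+(A_2x_k+\bar A_2\mathbb Ex_k+B_2u_k+\bar B_2\mathbb Eu_k)w_k,\quad x_0=z,\ k\ge0,$$ with $w_k$ independent scalar random variables of mean $0$ and variance $1$, and $z$ a square-integrable random vector in $\mathbb R^n$ independent of the noise. Controls are $u_k=Fx_k+\bar F\mathbb Ex_k$, $F,\bar F\in\mathbb R^{m\times n}$. A system is asymptotically mean-square stable (ASMS) if $\mathbb E\|x_k\|^2\to0$ for every initial state; the controlled system is stabilizable if some such feedback makes the closed loop ASMS. Stabilizing gains. With $\mathcal A_1^{F,\bar F}=\begin{bmatrix}\hat A_1+\hat B_1(F+\bar F)&0\\ 0&A_1+B_1F\end{bmatrix}$,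 $\mathcal A_2^{F}=\begin{bmatrix}0&0\\ 0&A_2+B_2F\end{bmatrix}$, $\mathcal A_3^{F,\bar F}=\begin{bmatrix}0&0\\ \hat A_2+\hat B_2(F+\bar F)&0\end{bmatrix}$, $\mathcal F$ is the set of pairs $(F,\bar F)$ such that the spectrum of the linear operator $\mathcal X\mapsto(\mathcal A_1^{F,\bar F})'\mathcal X\mathcal A_1^{F,\bar F}+(\mathcal A_2^F)'\mathcal X\mathcal A_2^F+(\mathcal A_3^{F,\bar F})'\mathcal X\mathcal A_3^{F,\bar F}$ on $\mathcal S_{2n}$ lies in the open unit disc. Augmented matrices (each displayed inner block is $(n+m)\times(n+m)$): $\mathbf A_1^{F,\bar F}=\mathrm{diag}\Big(\begin{bmatrix}\hat A_1&\hat B_1\\ (F+\bar F)\hat A_1&(F+\bar F)\hat B_1\end{bmatrix},\begin{bmatrix}A_1&B_1\\ F A_1&F B_1\end{bmatrix}\Big)$, $\mathbf A_2^F=\mathrm{diag}\Big(0,\begin{bmatrix}A_2&B_2\\ F A_2&F B_2\end{bmatrix}\Big)$, and $\mathbf A_3^F$ is the $2\times2$ block matrix whose only nonzero block is the lower-left one, $\begin{bmatrix}\hat A_2&\hat B_2\\ F\hat A_2&F\hat B_2\end{bmatrix}$. Also $\mathbb F_1=[I_n\ \ (F+\bar F)'\ \ 0\ \ 0]'$, $\mathbb F_2=[0\ \ 0\ \ I_n\ \ F']'$ (both $(2n+2m)\times n$). Define $\mathbf D^*_{F,\bar F}(\tilde S)=\mathbf A_1^{F,\bar F}\tilde S(\mathbf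 A_1^{F,\bar F})'+\mathbf A_2^F\tilde S(\mathbf A_2^F)'+\mathbf A_3^F\tilde S(\mathbf A_3^F)'$. Initial data. Random initial states $z_1,\dots,z_r$ are given with $\sum_l\mathbb Ez_l(\mathbb Ez_l)'=Z_2>0$ and $\sum_l\mathbb E[z_lz_l']=Z_1>Z_2$. Standing assumption. (i) $Q\ge0$, $Q+\bar Q\ge0$, $R>0$, $R+\bar R>0$; (ii) the system is stabilizable; (iii) the uncontrolled system ($u\equiv0$) with output $y_k=\mathcal Q^{1/2}\begin{bmatrix}\mathbb Ex_k\\ x_k-\mathbb Ex_k\end{bmatrix}$, $\mathcal Q=\mathrm{diag}(\hat Q,Q)$, is exactly observable (there is $T\in\mathbb N$ such that $y_k=0$ a.s. for $k=0,\dots,T$ implies $x_0=0$) or exactly detectable ($y_k=0$ a.s. for all $k$ implies $\mathbb E\|x_k\|^2\to0$). *)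

theory Defs
  imports "HOL-Probability.Probability"
begin

text \<open>
  A \<open>p \<times> q\<close> matrix has type \<^typ>\<open>real^'q^'p\<close>. Block matrices are indexed by sum types, so that
  \<^typ>\<open>'n + 'm\<close> is the index set of size \<open>n + m\<close>.
\<close>

definition sym_mats :: "(real^'k^'k) set" where
  "sym_mats = {S. transpose S = S}"

definition psd :: "real^'k^'k \<Rightarrow> bool" where
  "psd S \<longleftrightarrow> S \<in> sym_mats \<and> (\<forall>x. 0 \<le> x \<bullet> (S *v x))"

definition posdef :: "real^'k^'k \<Rightarrow> bool" where
  "posdef S \<longleftrightarrow> S \<in> sym_mats \<and> (\<forall>x. x \<noteq> 0 \<longrightarrow> 0 < x \<bullet> (S *v x))"

definition psd_sqrt :: "real^'k^'k \<Rightarrow> real^'k^'k" where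
  "psd_sqrt S = (THE H. psd H \<and> H ** H = S)"

definition outer_prod :: "real^'p \<Rightarrow> real^'q \<Rightarrow> real^'q^'p" where
  "outer_prod v w = (\<chi> i j. v $ i * w $ j)"

definition vec_append :: "'a^'p \<Rightarrow> 'a^'q \<Rightarrow> 'a^('p + 'q)" where
  "vec_append v w = (\<chi> i. case i of Inl a \<Rightarrow> v $ a | Inr b \<Rightarrow> w $ b)"

text \<open>Since the rows of a matrix are vectors, \<^const>\<open>vec_append\<close> also stacks matrices vertically.\<close>

definition block_mat ::
  "real^'c^'a \<Rightarrow> real^'d^'a \<Rightarrow> real^'c^'b \<Rightarrow> real^'d^'b \<Rightarrow> real^('c + 'd)^('a + 'b)" where
  "block_mat A B C D =
     vec_append (\<chi> i. vec_append (A $ i) (B $ i)) (\<chi> i. vec_append (C $ i) (D $ i))"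

definition block_diag :: "real^'c^'a \<Rightarrow> real^'d^'b \<Rightarrow> real^('c + 'd)^('a + 'b)" where
  "block_diag A D = block_mat A 0 0 D"

text \<open>
  Spectrum of a linear operator \<open>T\<close> on a finite-dimensional real vector space \<open>V\<close>: the complex
  eigenvalues of its complexification. An eigenvector \<open>u + \<i> v\<close> is given by its real and imaginary
  parts \<open>u, v \<in> V\<close>, and the two equations are those of \<open>T u + \<i> T v = c (u + \<i> v)\<close>.
\<close>

definition op_spectrum :: "'v::real_vector set \<Rightarrow> ('v \<Rightarrow> 'v) \<Rightarrow> complex set" where
  "op_spectrum V T = {c. \<exists>u\<in>V. \<exists>v\<in>V. (u \<noteq> 0 \<or> v \<noteq> 0) \<and>
      T u = Re c *\<^sub>R u - Im c *\<^sub>R v \<and> T v = Im c *\<^sub>R u + Re c *\<^sub>R v}"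

record ('n::finite, 'm::finite) mf_system =
  A1 :: "real^'n^'n"
  A1bar :: "real^'n^'n"
  A2 :: "real^'n^'n"
  A2bar :: "real^'n^'n"
  B1 :: "real^'m^'n"
  B1bar :: "real^'m^'n"
  B2 :: "real^'m^'n"
  B2bar :: "real^'m^'n"

definition A1hat :: "('n::finite, 'm::finite) mf_system \<Rightarrow> real^'n^'n" where
  "A1hat sys = A1 sys + A1bar sys"

definition A2hat :: "('n::finite, 'm::finite) mf_system \<Rightarrow> real^'n^'n" where
  "A2hat sys = A2 sys + A2bar sys"

definition B1hat :: "('n::finite, 'm::finite) mf_system \<Rightarrow> real^'m^'n" where
  "B1hat sys = B1 sys + B1bar sys"

definition B2hat :: "('n::finite, 'm::finite) mf_system \<Rightarrow> real^'m^'n" where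
  "B2hat sys = B2 sys + B2bar sys"

definition noise :: "'w measure \<Rightarrow> (nat \<Rightarrow> 'w \<Rightarrow> real) \<Rightarrow> bool" where
  "noise M w \<longleftrightarrow>
     prob_space.indep_vars M (\<lambda>_. borel) w UNIV \<and>
     (\<forall>k. integrable M (w k) \<and> integrable M (\<lambda>\<omega>. (w k \<omega>)\<^sup>2) \<and>
          (\<integral>\<omega>. w k \<omega> \<partial>M) = 0 \<and> (\<integral>\<omega>. (w k \<omega> - (\<integral>\<eta>. w k \<eta> \<partial>M))\<^sup>2 \<partial>M) = 1)"

text \<open>
  Independence of \<open>z\<close> from the noise is independence of the sigma-algebras generated by \<open>z\<close> and by
  the whole sequence \<open>w\<close>.
\<close>

definition initial_state :: "'w measure \<Rightarrow> (nat \<Rightarrow> 'w \<Rightarrow> real) \<Rightarrow> ('w \<Rightarrow> real^'n) \<Rightarrow> bool" where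
  "initial_state M w z \<longleftrightarrow>
     z \<in> borel_measurable M \<and> integrable M (\<lambda>\<omega>. (norm (z \<omega>))\<^sup>2) \<and>
     prob_space.indep_set M
       (sets (vimage_algebra (space M) z borel))
       (sets (vimage_algebra (space M) (\<lambda>\<omega> k. w k \<omega>) (Pi\<^sub>M UNIV (\<lambda>_. borel))))"

definition mf_step :: "'w measure \<Rightarrow> ('n::finite, 'm::finite) mf_system \<Rightarrow>
    ('w \<Rightarrow> real^'n) \<Rightarrow> ('w \<Rightarrow> real^'m) \<Rightarrow> ('w \<Rightarrow> real) \<Rightarrow> 'w \<Rightarrow> real^'n" where
  "mf_step M sys x u w \<omega> =
     (let Ex = (\<integral>\<eta>. x \<eta> \<partial>M); Eu = (\<integral>\<eta>. u \<eta> \<partial>M) in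
       (A1 sys *v x \<omega> + A1bar sys *v Ex + B1 sys *v u \<omega> + B1bar sys *v Eu)
       + w \<omega> *\<^sub>R (A2 sys *v x \<omega> + A2bar sys *v Ex + B2 sys *v u \<omega> + B2bar sys *v Eu))"

primrec closed_loop :: "'w measure \<Rightarrow> (nat \<Rightarrow> 'w \<Rightarrow> real) \<Rightarrow> ('n::finite, 'm::finite) mf_system \<Rightarrow>
    real^'n^'m \<Rightarrow> real^'n^'m \<Rightarrow> ('w \<Rightarrow> real^'n) \<Rightarrow> nat \<Rightarrow> 'w \<Rightarrow> real^'n" where
  "closed_loop M w sys F Fbar z 0 = z"
| "closed_loop M w sys F Fbar z (Suc k) =
     (let x = closed_loop M w sys F Fbar z k in
       mf_step M sys x (\<lambda>\<omega>. F *v x \<omega> + Fbar *v (\<integral>\<eta>. x \<eta> \<partial>M)) (w k))"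

primrec uncontrolled :: "'w measure \<Rightarrow> (nat \<Rightarrow> 'w \<Rightarrow> real) \<Rightarrow> ('n::finite, 'm::finite) mf_system \<Rightarrow>
    ('w \<Rightarrow> real^'n) \<Rightarrow> nat \<Rightarrow> 'w \<Rightarrow> real^'n" where
  "uncontrolled M w sys z 0 = z"
| "uncontrolled M w sys z (Suc k) = mf_step M sys (uncontrolled M w sys z k) (\<lambda>_. 0) (w k)"

definition ms_to_zero :: "'w measure \<Rightarrow> (nat \<Rightarrow> 'w \<Rightarrow> real^'n) \<Rightarrow> bool" where
  "ms_to_zero M x \<longleftrightarrow> (\<lambda>k. \<integral>\<omega>. (norm (x k \<omega>))\<^sup>2 \<partial>M) \<longlonglongrightarrow> 0"

definition stabilizable ::
  "'w measure \<Rightarrow> (nat \<Rightarrow> 'w \<Rightarrow> real) \<Rightarrow> ('n::finite, 'm::finite) mf_system \<Rightarrow> bool" where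
  "stabilizable M w sys \<longleftrightarrow>
     (\<exists>F Fbar. \<forall>z. initial_state M w z \<longrightarrow> ms_to_zero M (closed_loop M w sys F Fbar z))"

definition mf_output :: "'w measure \<Rightarrow> (nat \<Rightarrow> 'w \<Rightarrow> real) \<Rightarrow> ('n::finite, 'm::finite) mf_system \<Rightarrow>
    real^'n^'n \<Rightarrow> real^'n^'n \<Rightarrow> ('w \<Rightarrow> real^'n) \<Rightarrow> nat \<Rightarrow> 'w \<Rightarrow> real^('n + 'n)" where
  "mf_output M w sys Q Qbar z k \<omega> =
     (let x = uncontrolled M w sys z k; Ex = (\<integral>\<eta>. x \<eta> \<partial>M) in
       psd_sqrt (block_diag (Q + Qbar) Q) *v vec_append Ex (x \<omega> - Ex))"

definition exactly_observable :: "'w measure \<Rightarrow> (nat \<Rightarrow> 'w \<Rightarrow> real) \<Rightarrow>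
    ('n::finite, 'm::finite) mf_system \<Rightarrow> real^'n^'n \<Rightarrow> real^'n^'n \<Rightarrow> bool" where
  "exactly_observable M w sys Q Qbar \<longleftrightarrow>
     (\<exists>T. \<forall>z. initial_state M w z \<longrightarrow>
        (\<forall>k\<le>T. AE \<omega> in M. mf_output M w sys Q Qbar z k \<omega> = 0) \<longrightarrow> (AE \<omega> in M. z \<omega> = 0))"

definition exactly_detectable :: "'w measure \<Rightarrow> (nat \<Rightarrow> 'w \<Rightarrow> real) \<Rightarrow>
    ('n::finite, 'm::finite) mf_system \<Rightarrow> real^'n^'n \<Rightarrow> real^'n^'n \<Rightarrow> bool" where
  "exactly_detectable M w sys Q Qbar \<longleftrightarrow>
     (\<forall>z. initial_state M w z \<longrightarrow>
        (\<forall>k. AE \<omega> in M. mf_output M w sys Q Qbar z k \<omega> = 0) \<longrightarrow>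
        ms_to_zero M (uncontrolled M w sys z))"

definition cal_A1 :: "('n::finite, 'm::finite) mf_system \<Rightarrow> real^'n^'m \<Rightarrow> real^'n^'m \<Rightarrow>
    real^('n + 'n)^('n + 'n)" where
  "cal_A1 sys F Fbar = block_diag (A1hat sys + B1hat sys ** (F + Fbar)) (A1 sys + B1 sys ** F)"

definition cal_A2 :: "('n::finite, 'm::finite) mf_system \<Rightarrow> real^'n^'m \<Rightarrow>
    real^('n + 'n)^('n + 'n)" where
  "cal_A2 sys F = block_diag 0 (A2 sys + B2 sys ** F)"

definition cal_A3 :: "('n::finite, 'm::finite) mf_system \<Rightarrow> real^'n^'m \<Rightarrow> real^'n^'m \<Rightarrow>
    real^('n + 'n)^('n + 'n)" where
  "cal_A3 sys F Fbar = block_mat 0 0 (A2hat sys + B2hat sys ** (F + Fbar)) 0"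

definition stab_gains :: "('n::finite, 'm::finite) mf_system \<Rightarrow> ((real^'n^'m) \<times> (real^'n^'m)) set" where
  "stab_gains sys = {(F, Fbar).
     op_spectrum sym_mats
       (\<lambda>X. transpose (cal_A1 sys F Fbar) ** X ** cal_A1 sys F Fbar
          + transpose (cal_A2 sys F) ** X ** cal_A2 sys F
          + transpose (cal_A3 sys F Fbar) ** X ** cal_A3 sys F Fbar)
     \<subseteq> ball 0 1}"

definition aug_block :: "real^'n^'n \<Rightarrow> real^'m^'n \<Rightarrow> real^'n^'m \<Rightarrow> real^('n + 'm)^('n + 'm)" where
  "aug_block A B K = block_mat A B (K ** A) (K ** B)"

definition aug_A1 :: "('n::finite, 'm::finite) mf_system \<Rightarrow> real^'n^'m \<Rightarrow> real^'n^'m \<Rightarrow>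
    real^(('n + 'm) + ('n + 'm))^(('n + 'm) + ('n + 'm))" where
  "aug_A1 sys F Fbar =
     block_diag (aug_block (A1hat sys) (B1hat sys) (F + Fbar)) (aug_block (A1 sys) (B1 sys) F)"

definition aug_A2 :: "('n::finite, 'm::finite) mf_system \<Rightarrow> real^'n^'m \<Rightarrow>
    real^(('n + 'm) + ('n + 'm))^(('n + 'm) + ('n + 'm))" where
  "aug_A2 sys F = block_diag 0 (aug_block (A2 sys) (B2 sys) F)"

definition aug_A3 :: "('n::finite, 'm::finite) mf_system \<Rightarrow> real^'n^'m \<Rightarrow>
    real^(('n + 'm) + ('n + 'm))^(('n + 'm) + ('n + 'm))" where
  "aug_A3 sys F = block_mat 0 0 (aug_block (A2hat sys) (B2hat sys) F) 0"

definition D_star :: "('n::finite, 'm::finite) mf_system \<Rightarrow> real^'n^'m \<Rightarrow> real^'n^'m \<Rightarrow>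
    real^(('n + 'm) + ('n + 'm))^(('n + 'm) + ('n + 'm)) \<Rightarrow>
    real^(('n + 'm) + ('n + 'm))^(('n + 'm) + ('n + 'm))" where
  "D_star sys F Fbar S =
     aug_A1 sys F Fbar ** S ** transpose (aug_A1 sys F Fbar)
     + aug_A2 sys F ** S ** transpose (aug_A2 sys F)
     + aug_A3 sys F ** S ** transpose (aug_A3 sys F)"

definition FF1 :: "real^'n^'m \<Rightarrow> real^'n^'m \<Rightarrow> real^'n^(('n + 'm) + ('n + 'm))" where
  "FF1 F Fbar = vec_append (vec_append (mat 1) (F + Fbar)) 0"

definition FF2 :: "real^'n^'m \<Rightarrow> real^'n^(('n + 'm) + ('n + 'm))" where
  "FF2 F = vec_append 0 (vec_append (mat 1) F)"

definition init_term :: "real^'n^'m \<Rightarrow> real^'n^'m \<Rightarrow> real^'n^'n \<Rightarrow> real^'n^'n \<Rightarrow>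
    real^(('n + 'm) + ('n + 'm))^(('n + 'm) + ('n + 'm))" where
  "init_term F Fbar Z1 Z2 =
     FF1 F Fbar ** Z2 ** transpose (FF1 F Fbar) + FF2 F ** (Z1 - Z2) ** transpose (FF2 F)"

definition weight :: "real^'n^'n \<Rightarrow> real^'n^'n \<Rightarrow> real^'m^'m \<Rightarrow> real^'m^'m \<Rightarrow>
    real^(('n + 'm) + ('n + 'm))^(('n + 'm) + ('n + 'm))" where
  "weight Q Qbar R Rbar =
     block_diag (block_diag Q R + block_diag Qbar Rbar) (block_diag Q R)"

text \<open>Optimal values are extended reals: the inner infimum of the dual problem may be \<open>-\<infinity>\<close>.\<close>

definition primal_value :: "('n::finite, 'm::finite) mf_system \<Rightarrow> real^'n^'n \<Rightarrow> real^'n^'n \<Rightarrow>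
    real^'m^'m \<Rightarrow> real^'m^'m \<Rightarrow> real^'n^'n \<Rightarrow> real^'n^'n \<Rightarrow> ereal" where
  "primal_value sys Q Qbar R Rbar Z1 Z2 =
     Inf {ereal (trace (weight Q Qbar R Rbar ** S)) | S F Fbar.
            S \<in> sym_mats \<and> (F, Fbar) \<in> stab_gains sys \<and>
            D_star sys F Fbar S + init_term F Fbar Z1 Z2 = S}"

definition lagrangian :: "('n::finite, 'm::finite) mf_system \<Rightarrow> real^'n^'n \<Rightarrow> real^'n^'n \<Rightarrow>
    real^'m^'m \<Rightarrow> real^'m^'m \<Rightarrow> real^'n^'n \<Rightarrow> real^'n^'n \<Rightarrow>
    real^(('n + 'm) + ('n + 'm))^(('n + 'm) + ('n + 'm)) \<Rightarrow> real^'n^'m \<Rightarrow> real^'n^'m \<Rightarrow>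
    real^(('n + 'm) + ('n + 'm))^(('n + 'm) + ('n + 'm)) \<Rightarrow> real" where
  "lagrangian sys Q Qbar R Rbar Z1 Z2 X F Fbar S =
     trace (weight Q Qbar R Rbar ** S)
     + trace ((D_star sys F Fbar S - S + init_term F Fbar Z1 Z2) ** X)"

definition dual_value :: "('n::finite, 'm::finite) mf_system \<Rightarrow> real^'n^'n \<Rightarrow> real^'n^'n \<Rightarrow>
    real^'m^'m \<Rightarrow> real^'m^'m \<Rightarrow> real^'n^'n \<Rightarrow> real^'n^'n \<Rightarrow> ereal" where
  "dual_value sys Q Qbar R Rbar Z1 Z2 =
     (SUP X\<in>sym_mats.
        Inf {ereal (lagrangian sys Q Qbar R Rbar Z1 Z2 X F Fbar S) | S F Fbar.
               psd S \<and> (F, Fbar) \<in> stab_gains sys})"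

end

theory Submission
  imports Defs
begin

text \<open>
  The state of the closed loop is followed as the pair of its mean and its deviation from the mean.
  In these coordinates a pair of gains enters only through one matrix \<open>G\<close> (\<open>gain_mat\<close>) and the
  system only through three rectangular matrices \<open>E\<^sub>i\<close> (\<open>open_A1\<close>, \<open>open_A2\<close>, \<open>open_A3\<close>): the
  matrices that define the stabilizing gains are \<open>E\<^sub>i G\<close>, and the augmented matrices of the primal
  constraint are \<open>G E\<^sub>i\<close>. Put \<open>H X = W + \<Sum>\<^sub>i E\<^sub>i\<^sup>T X E\<^sub>i\<close> with \<open>W\<close> the cost weight, and
  \<open>T\<^sub>g X = G\<^sup>T (H X) G\<close> for a gain pair \<open>g\<close>; this is the cost of one step under \<open>g\<close> followed by the
  terminal cost \<open>X\<close>. Its linear part is the operator \<open>L\<^sub>g\<close> whose spectrum defines stability. A matrix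
  \<open>S\<close> satisfies the primal constraint only if \<open>S = G Y G\<^sup>T\<close> with \<open>Y = L\<^sub>g\<^sup>* Y + Z\<close>, where
  \<open>Z = diag (Z\<^sub>2, Z\<^sub>1 - Z\<^sub>2)\<close>.

  Weak duality: on a feasible point the Lagrangian is the objective, so the only thing to see is that
  a feasible \<open>S\<close> is positive semidefinite (\<open>feasible_imp_psd\<close>). This is Lyapunov theory for positive
  maps: if the spectrum lies in the disc, there is \<open>X \<ge> 0\<close> with \<open>X - L\<^sub>g X > 0\<close>
  (\<open>spectrum_in_disc_imp_lyapunov\<close>), and then \<open>Y = L\<^sub>g\<^sup>* Y + Z\<close> with \<open>Z \<ge> 0\<close> forces \<open>Y \<ge> 0\<close>.

  The reverse inequality does not go through a Riccati equation but through a damped value iteration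
  \<open>X' = (X + T\<^sub>h X) / 2\<close>, where \<open>h\<close> is the gain pair that minimizes \<open>T\<^sub>h X\<close> in the order of symmetric
  matrices (\<open>greedy_gain\<close>). It starts from a strict supersolution, \<open>X > T\<^sub>g X\<close>, and each step yields
  another strict supersolution, now for \<open>h\<close>. Strictness makes \<open>X'\<close> a Lyapunov matrix of \<open>h\<close>, so \<open>h\<close> is
  stabilizing and the primal value is at most \<open>trace (X' Z)\<close>. The iterates decrease to a limit \<open>P\<close>
  with \<open>P \<le> T\<^sub>g P\<close> for all gain pairs \<open>g\<close>, stabilizing or not. With the multiplier \<open>H P\<close> this
  inequality bounds the Lagrangian below by \<open>trace (P Z)\<close> for every \<open>S \<ge> 0\<close> and every gain pair.
  Hence \<open>primal \<le> trace (P Z) \<le> dual \<le> primal\<close>.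

  The first supersolution comes from the probabilistic hypotheses. For a stabilizing feedback, the
  second moments at time \<open>k\<close> of the trajectories started at the given initial states add up to
  \<open>trace (Z L\<^sub>g\<^sup>k I)\<close> (\<open>second_moment_closed_loop\<close>, \<open>initial_second_moment\<close>), which therefore
  tends to \<open>0\<close>. As \<open>Z > 0\<close>, some \<open>L\<^sub>g\<^sup>k I\<close> is below \<open>I / 2\<close>, and a multiple of
  \<open>I + L\<^sub>g I + \<dots> + L\<^sub>g\<^sup>k\<^sup>-\<^sup>1 I\<close> is a strict supersolution.
\<close>

section \<open>Quadratic forms and positive semidefinite matrices\<close>

text \<open>
  The order of symmetric matrices is handled pointwise through these forms: \<open>X \<le> Y\<close> is written
  \<open>psd (Y - X)\<close>.
\<close>

definition qform :: "real^'k^'k \<Rightarrow> real^'k \<Rightarrow> real" where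
  "qform S x = x \<bullet> (S *v x)"

lemma qform_simps [simp]:
  "qform (S + T) x = qform S x + qform T x"
  "qform (S - T) x = qform S x - qform T x"
  "qform (- S) x = - qform S x"
  "qform (c *\<^sub>R S) x = c * qform S x"
  "qform 0 x = 0"
  "qform (mat 1) x = x \<bullet> x"
proof -
  have neg: "(- S) *v x = - (S *v x)"
    using matrix_vector_mult_diff_rdistrib[of 0 S x] by simp
  show "qform (- S) x = - qform S x"
    by (simp add: qform_def neg)
qed (simp_all add: qform_def matrix_vector_mult_add_rdistrib matrix_vector_mult_diff_rdistrib
      inner_add_right inner_diff_right flip: scaleR_matrix_vector_assoc)

lemma inner_transpose_mult: "(transpose A *v x) \<bullet> y = x \<bullet> ((A :: real^'p^'q) *v y)"
  using dot_lmul_matrix[of x A y] by simp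

lemma qform_congruence: "qform (transpose A ** S ** A) x = qform S (A *v x)"
proof -
  have "(transpose A ** S ** A) *v x = transpose A *v (S *v (A *v x))"
    by (simp add: matrix_vector_mul_assoc matrix_mul_assoc del: transpose_matrix_vector)
  then show ?thesis
    unfolding qform_def by (metis inner_commute inner_transpose_mult)
qed

lemma transpose_add: "transpose (A + B) = transpose A + transpose (B :: real^'p^'q)"
  and transpose_diff: "transpose (A - B) = transpose A - transpose (B :: real^'p^'q)"
  and transpose_zero: "transpose (0 :: real^'p^'q) = 0"
  and transpose_uminus: "transpose (- A) = - transpose (A :: real^'p^'q)"
  by (simp_all add: transpose_def vec_eq_iff)

lemma sym_mats_intros [intro]:
  "S \<in> sym_mats \<Longrightarrow> T \<in> sym_mats \<Longrightarrow> S + T \<in> sym_mats"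
  "S \<in> sym_mats \<Longrightarrow> T \<in> sym_mats \<Longrightarrow> S - T \<in> sym_mats"
  "S \<in> sym_mats \<Longrightarrow> c *\<^sub>R S \<in> sym_mats"
  "S \<in> sym_mats \<Longrightarrow> - S \<in> sym_mats"
  "0 \<in> sym_mats"
  "mat 1 \<in> sym_mats"
  "S \<in> sym_mats \<Longrightarrow> transpose A ** S ** A \<in> sym_mats"
  by (simp_all add: sym_mats_def transpose_add transpose_diff transpose_zero transpose_uminus
      transpose_scalar matrix_transpose_mul matrix_mul_assoc)

lemma inner_sym_mats: "S \<in> sym_mats \<Longrightarrow> x \<bullet> (S *v y) = y \<bullet> (S *v x)"
  by (metis (mono_tags, lifting) inner_commute inner_transpose_mult mem_Collect_eq sym_mats_def)

lemma qform_add_vec: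
  "S \<in> sym_mats \<Longrightarrow> qform S (x + y) = qform S x + 2 * (x \<bullet> (S *v y)) + qform S y"
  using inner_sym_mats[of S x y]
  by (simp add: qform_def matrix_vector_right_distrib inner_add_left inner_add_right)

lemma qform_scale_vec: "qform S (c *\<^sub>R x) = c\<^sup>2 * qform S x"
  by (simp add: qform_def matrix_vector_mult_scaleR power2_eq_square)

lemma nth_eq_inner_axis: "S $ i $ j = axis i 1 \<bullet> ((S :: real^'p^'q) *v axis j 1)"
  by (simp add: inner_axis' matrix_vector_mult_basis column_def)

text \<open>
  Polarization lets convergence, equality and boundedness of symmetric matrices be checked on
  quadratic forms.
\<close>

lemma sym_mats_polarization:
  assumes "S \<in> sym_mats"
  shows "S $ i $ j = (qform S (axis i 1 + axis j 1) - qform S (axis i 1) - qform S (axis j 1)) / 2"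
  using qform_add_vec[OF assms, of "axis i 1" "axis j 1"] by (simp add: nth_eq_inner_axis)

lemma sym_mats_eqI:
  assumes "S \<in> sym_mats" "T \<in> sym_mats" "\<And>x. qform S x = qform T x"
  shows "S = T"
  by (simp add: vec_eq_iff sym_mats_polarization[OF assms(1)] sym_mats_polarization[OF assms(2)]
      assms(3))

lemma tendsto_qform:
  assumes "(X \<longlongrightarrow> S) F"
  shows "((\<lambda>k. qform (X k) x) \<longlongrightarrow> qform S x) F"
proof -
  have "linear (\<lambda>S. qform S x)"
    by (rule linearI) simp_all
  then have "bounded_linear (\<lambda>S. qform S x)"
    by (simp add: linear_conv_bounded_linear)
  from bounded_linear.tendsto[OF this assms] show ?thesis .
qed

lemma tendsto_matI:
  assumes "\<And>i j. ((\<lambda>k. X k $ i $ j) \<longlongrightarrow> S $ i $ j) F"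
  shows "(X \<longlongrightarrow> (S :: real^'p^'q)) F"
  by (intro vec_tendstoI assms)

lemma tendsto_transpose: "(X \<longlongrightarrow> S) F \<Longrightarrow> ((\<lambda>k. transpose (X k)) \<longlongrightarrow> transpose (S :: real^'p^'q)) F"
  unfolding transpose_def by (intro tendsto_vec_lambda tendsto_vec_nth)

lemma tendsto_sym_mats:
  assumes "\<And>k. X k \<in> sym_mats" "X \<longlonglongrightarrow> S"
  shows "S \<in> sym_mats"
  using tendsto_transpose[OF assms(2)] assms LIMSEQ_unique
  by (fastforce simp: sym_mats_def)

lemma psd_iff: "psd S \<longleftrightarrow> S \<in> sym_mats \<and> (\<forall>x. 0 \<le> qform S x)"
  by (simp add: psd_def qform_def)

lemma posdef_iff: "posdef S \<longleftrightarrow> S \<in> sym_mats \<and> (\<forall>x. x \<noteq> 0 \<longrightarrow> 0 < qform S x)"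
  by (simp add: posdef_def qform_def)

lemma psd_imp_sym: "psd S \<Longrightarrow> S \<in> sym_mats"
  and psdD: "psd S \<Longrightarrow> 0 \<le> qform S x"
  by (simp_all add: psd_iff)

lemma psdI: "S \<in> sym_mats \<Longrightarrow> (\<And>x. 0 \<le> qform S x) \<Longrightarrow> psd S"
  by (simp add: psd_iff)

lemma posdef_imp_psd: "posdef S \<Longrightarrow> psd S"
  by (metis order.refl order.strict_implies_order posdef_iff psd_iff qform_def inner_zero_left)

lemma psd_intros [intro]:
  "psd 0"
  "psd (mat 1)"
  "psd S \<Longrightarrow> psd T \<Longrightarrow> psd (S + T)"
  "0 \<le> c \<Longrightarrow> psd S \<Longrightarrow> psd (c *\<^sub>R S)"
  "psd S \<Longrightarrow> psd (transpose A ** S ** A)"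
  by (auto simp: psd_iff qform_congruence)

lemma psd_outer_prod: "psd (outer_prod v v)"
  and qform_outer_prod: "qform (outer_prod v v) x = (v \<bullet> x)\<^sup>2"
proof -
  have mv: "outer_prod v v *v x = (v \<bullet> x) *\<^sub>R v" for x
    by (simp add: outer_prod_def matrix_vector_mult_def vec_eq_iff inner_vec_def sum_distrib_left
        sum_distrib_right mult_ac)
  show "qform (outer_prod v v) x = (v \<bullet> x)\<^sup>2" for x
    by (simp add: qform_def mv inner_commute power2_eq_square)
  then show "psd (outer_prod v v)"
    by (auto simp: psd_iff sym_mats_def outer_prod_def transpose_def vec_eq_iff)
qed

lemma tendsto_psd: "(\<And>k. psd (X k)) \<Longrightarrow> X \<longlonglongrightarrow> S \<Longrightarrow> psd S"
  using tendsto_sym_mats[of X S] tendsto_qform[of X S sequentially]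
  by (meson LIMSEQ_le_const psd_iff)

text \<open>
  The quadratic \<open>t \<mapsto> qform S (x + t y)\<close> is nonnegative, so its discriminant is not positive; if its
  leading coefficient vanishes, it is affine and nonnegative, so its slope vanishes.
\<close>

lemma psd_cauchy_schwarz:
  assumes "psd S"
  shows "(x \<bullet> (S *v y))\<^sup>2 \<le> qform S x * qform S y"
proof -
  define a b c where "a = qform S x" and "b = x \<bullet> (S *v y)" and "c = qform S y"
  have quad: "0 \<le> a + 2 * t * b + t\<^sup>2 * c" for t
    using psdD[OF assms, of "x + t *\<^sub>R y"]
    by (simp add: qform_add_vec[OF psd_imp_sym[OF assms]] qform_scale_vec matrix_vector_mult_scaleR
        a_def b_def c_def algebra_simps)
  have "c \<ge> 0" using psdD[OF assms] by (simp add: c_def)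
  show ?thesis
  proof (cases "c = 0")
    case True
    have "b = 0"
    proof (rule ccontr)
      assume "b \<noteq> 0"
      then show False using quad[of "- (a + 1) / (2 * b)"] True by (simp add: field_simps)
    qed
    then show ?thesis using psdD[OF assms] by (simp add: b_def)
  next
    case False
    then have "c > 0" using \<open>c \<ge> 0\<close> by simp
    have "0 \<le> a + 2 * (- b / c) * b + (- b / c)\<^sup>2 * c" by (rule quad)
    also have "\<dots> = (a * c - b\<^sup>2) / c"
      using \<open>c > 0\<close> by (simp add: field_simps power2_eq_square)
    finally show ?thesis
      using \<open>c > 0\<close> by (simp add: zero_le_divide_iff a_def b_def c_def)
  qed
qed

text \<open>
  A Cholesky elimination in place of the spectral theorem: subtracting the outer square of a scaled
  column with nonzero pivot keeps the matrix positive semidefinite by the Cauchy-Schwarz inequality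
  and clears the pivot. A zero diagonal entry forces its row to vanish, so entries already cleared
  stay zero and the number of nonzero diagonal entries drops.
\<close>

lemma psd_sum_outer_prod:
  fixes S :: "real^'k^'k"
  assumes "psd S"
  shows "\<exists>vs. S = (\<Sum>v\<leftarrow>vs. outer_prod v v)"
  using assms
proof (induction "card {i. S $ i $ i \<noteq> 0}" arbitrary: S rule: less_induct)
  case less
  have row0: "S $ i $ j = 0" if "psd S" "S $ i $ i = 0" for i j and S :: "real^'k^'k"
    using psd_cauchy_schwarz[OF \<open>psd S\<close>, of "axis i 1" "axis j 1"] that
    by (simp add: qform_def flip: nth_eq_inner_axis)
  show ?case
  proof (cases "\<forall>i. S $ i $ i = 0")
    case True
    then have "S = 0" using row0 \<open>psd S\<close> by (simp add: vec_eq_iff)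
    then show ?thesis by (intro exI[of _ "[]"]) simp
  next
    case False
    then obtain p where p: "S $ p $ p \<noteq> 0" by blast
    have pp: "qform S (axis p 1) = S $ p $ p"
      by (simp add: qform_def flip: nth_eq_inner_axis)
    have pos: "S $ p $ p > 0"
      using p psdD[OF \<open>psd S\<close>, of "axis p 1"] pp by simp
    define v where "v = (1 / sqrt (S $ p $ p)) *\<^sub>R (S *v axis p 1)"
    define T where "T = S - outer_prod v v"
    have T: "psd T"
    proof (rule psdI)
      show "T \<in> sym_mats"
        unfolding T_def using \<open>psd S\<close> psd_outer_prod psd_imp_sym by blast
      fix x
      have "(v \<bullet> x)\<^sup>2 = (x \<bullet> (S *v axis p 1))\<^sup>2 / (S $ p $ p)"
        using pos by (simp add: v_def power_divide inner_commute)
      also have "\<dots> \<le> qform S x"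
        using psd_cauchy_schwarz[OF \<open>psd S\<close>, of x "axis p 1"] pos pp
        by (simp add: field_simps)
      finally show "0 \<le> qform T x" by (simp add: T_def qform_outer_prod)
    qed
    have Tii: "T $ i $ i = S $ i $ i - (S $ i $ p)\<^sup>2 / S $ p $ p" for i
      using pos by (simp add: T_def outer_prod_def v_def matrix_vector_mult_basis column_def
          power2_eq_square)
    have "T $ i $ i = 0" if "S $ i $ i = 0" for i
      using row0[OF \<open>psd S\<close> that] that by (simp add: Tii)
    moreover have "T $ p $ p = 0" using pos by (simp add: Tii power2_eq_square)
    ultimately have "{i. T $ i $ i \<noteq> 0} \<subset> {i. S $ i $ i \<noteq> 0}"
      using p by auto
    then have "card {i. T $ i $ i \<noteq> 0} < card {i. S $ i $ i \<noteq> 0}"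
      by (intro psubset_card_mono) auto
    from less(1)[OF this T] obtain vs where "T = (\<Sum>v\<leftarrow>vs. outer_prod v v)" ..
    then have "S = (\<Sum>v\<leftarrow>v # vs. outer_prod v v)" by (simp add: T_def algebra_simps)
    then show ?thesis by blast
  qed
qed

lemma trace_scaleR: "trace (c *\<^sub>R (A :: real^'k^'k)) = c * trace A"
  by (simp add: trace_def sum_distrib_left)

lemma trace_zero [simp]: "trace (0 :: real^'k^'k) = 0"
  by (simp add: trace_def)

lemma trace_outer_prod_mult: "trace (outer_prod v v ** S) = qform S v"
  by (simp add: trace_def outer_prod_def matrix_matrix_mult_def qform_def inner_vec_def
      matrix_vector_mult_def sum_distrib_left)
     (subst sum.swap, simp add: mult_ac)

lemma matrix_mul_simps:
  "(A :: real^'p^'q) ** (B - C) = A ** B - A ** C"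
  "(A :: real^'p^'q) ** (B + C) = A ** B + A ** C"
  "(B' + C') ** (A :: real^'p^'q) = B' ** A + C' ** A"
  "(B' - C') ** (A :: real^'p^'q) = B' ** A - C' ** A"
  by (simp_all add: matrix_matrix_mult_def vec_eq_iff algebra_simps sum_subtractf sum.distrib)

lemma trace_mult_nonneg:
  assumes "psd A" "psd B"
  shows "0 \<le> trace (A ** B)"
proof -
  obtain vs where vs: "A = (\<Sum>v\<leftarrow>vs. outer_prod v v)"
    using psd_sum_outer_prod[OF assms(1)] by blast
  have "trace ((\<Sum>v\<leftarrow>vs. outer_prod v v) ** B) = (\<Sum>v\<leftarrow>vs. qform B v)"
    by (induction vs) (simp_all add: matrix_mul_simps trace_add trace_outer_prod_mult)
  then show ?thesis
    using psdD[OF assms(2)] by (auto simp: vs intro!: sum_list_nonneg)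
qed

lemma trace_mult_mono:
  assumes "psd Z" "psd (Y - X)"
  shows "trace (Z ** X) \<le> trace (Z ** Y)"
  using trace_mult_nonneg[OF assms] by (simp add: matrix_mul_simps trace_sub)

lemma psd_le_trace:
  assumes "psd S"
  shows "qform S x \<le> trace S * (x \<bullet> x)"
proof -
  obtain vs where vs: "S = (\<Sum>v\<leftarrow>vs. outer_prod v v)"
    using psd_sum_outer_prod[OF assms] by blast
  have tr: "trace (outer_prod v v) = v \<bullet> v" for v :: "real^'a"
    by (simp add: trace_def outer_prod_def inner_vec_def)
  have "qform (\<Sum>v\<leftarrow>vs. outer_prod v v) x \<le> trace (\<Sum>v\<leftarrow>vs. outer_prod v v) * (x \<bullet> x)"
  proof (induction vs)
    case (Cons v vs)
    then show ?case
      using Cauchy_Schwarz_ineq[of v x] by (simp add: trace_add tr qform_outer_prod algebra_simps)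
  qed simp
  then show ?thesis by (simp add: vs)
qed

lemma psd_trace_nonneg: "psd S \<Longrightarrow> 0 \<le> trace S"
  using trace_mult_nonneg[OF _ psd_intros(2)] by simp

lemma qform_le_norm: "\<bar>qform S x\<bar> \<le> onorm ((*v) S) * (norm x)\<^sup>2"
proof -
  have "\<bar>qform S x\<bar> \<le> norm x * norm (S *v x)"
    unfolding qform_def by (rule Cauchy_Schwarz_ineq2)
  also have "\<dots> \<le> norm x * (onorm ((*v) S) * norm x)"
    by (intro mult_left_mono onorm) auto
  finally show ?thesis by (simp add: power2_eq_square algebra_simps)
qed

lemma sym_mats_le_scaled_id:
  assumes "S \<in> sym_mats"
  obtains t where "0 < t" "psd (t *\<^sub>R mat 1 - S)" "psd (t *\<^sub>R mat 1 + S)"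
proof -
  define t where "t = onorm ((*v) S) + 1"
  have bound: "\<bar>qform S x\<bar> \<le> t * (x \<bullet> x)" for x
    using qform_le_norm[of S x] zero_le_power2[of "norm x"]
    unfolding t_def dot_square_norm distrib_right by linarith
  have "t > 0"
    using onorm_pos_le[of "(*v) S"] by (simp add: t_def add_nonneg_pos)
  moreover have "0 \<le> qform (t *\<^sub>R mat 1 - S) x" "0 \<le> qform (t *\<^sub>R mat 1 + S) x" for x
    using bound[of x] by (simp_all add: abs_le_iff)
  then have "psd (t *\<^sub>R mat 1 - S)" "psd (t *\<^sub>R mat 1 + S)"
    using assms by (auto intro!: psdI simp del: qform_simps)
  ultimately show ?thesis by (rule that)
qed

lemma posdef_ge_scaled_id:
  fixes S :: "real^'k^'k"
  assumes "posdef S"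
  obtains e where "0 < e" "psd (S - e *\<^sub>R mat 1)"
proof -
  have cont: "continuous_on (sphere 0 1) (qform S)"
    unfolding qform_def by (intro continuous_intros linear_continuous_on) auto
  obtain i :: 'k where True by blast
  have "axis i 1 \<in> sphere (0::real^'k) 1" by simp
  then obtain y where y: "y \<in> sphere 0 1" "\<And>x. x \<in> sphere 0 1 \<Longrightarrow> qform S y \<le> qform S x"
    using continuous_attains_inf[OF compact_sphere _ cont] by blast
  then have "y \<noteq> 0" by auto
  then have "0 < qform S y"
    using assms by (simp add: posdef_iff)
  moreover have "psd (S - qform S y *\<^sub>R mat 1)"
  proof (rule psdI)
    show "S - qform S y *\<^sub>R mat 1 \<in> sym_mats" using assms by (auto simp: posdef_iff)
    fix x
    show "0 \<le> qform (S - qform S y *\<^sub>R mat 1) x"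
    proof (cases "x = 0")
      case False
      have "qform S y \<le> qform S ((1 / norm x) *\<^sub>R x)"
        using False by (intro y) simp
      then show ?thesis
        using False by (simp add: qform_scale_vec field_simps dot_square_norm)
    qed (simp add: qform_def)
  qed
  ultimately show ?thesis by (rule that)
qed

lemma psd_ge_scaled_id_imp_posdef: "0 < e \<Longrightarrow> psd (S - e *\<^sub>R mat 1) \<Longrightarrow> posdef S"
proof -
  assume e: "0 < e" "psd (S - e *\<^sub>R mat 1)"
  have "(S - e *\<^sub>R mat 1) + e *\<^sub>R mat 1 \<in> sym_mats"
    using e(2) psd_imp_sym by blast
  moreover have "0 < qform S x" if "x \<noteq> 0" for x
    using psdD[OF e(2), of x] e(1) that inner_gt_zero_iff[of x] by (smt (verit) mult_pos_pos qform_simps)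
  ultimately show ?thesis by (simp add: posdef_iff)
qed

text \<open>
  Monotone convergence for the order of symmetric matrices: each quadratic form is a bounded
  increasing real sequence, and polarization passes this to the entries.
\<close>

lemma psd_incseq_convergent:
  fixes X :: "nat \<Rightarrow> real^'k^'k"
  assumes sym: "\<And>k. X k \<in> sym_mats"
    and mono: "\<And>k. psd (X (Suc k) - X k)"
    and bound: "\<And>k x. qform (X k) x \<le> b (x :: real^'k)"
  obtains S where "S \<in> sym_mats" "X \<longlonglongrightarrow> S"
proof -
  have "convergent (\<lambda>k. qform (X k) x)" for x
  proof -
    have "incseq (\<lambda>k. qform (X k) x)"
      using psdD[OF mono, where x = x] by (intro incseq_SucI) simp
    moreover have "bdd_above (range (\<lambda>k. qform (X k) x))"
      using bound by (intro bdd_aboveI[of _ "b x"]) auto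
    ultimately show ?thesis
      using LIMSEQ_incseq_SUP unfolding convergent_def by blast
  qed
  then obtain q where q: "(\<lambda>k. qform (X k) x) \<longlonglongrightarrow> q x" for x
    unfolding convergent_def by metis
  have "X \<longlonglongrightarrow> (\<chi> i j. (q (axis i 1 + axis j 1) - q (axis i 1) - q (axis j 1)) / 2)"
  proof (rule tendsto_matI)
    fix i j
    show "(\<lambda>k. X k $ i $ j) \<longlonglongrightarrow>
        (\<chi> i j. (q (axis i 1 + axis j 1) - q (axis i 1) - q (axis j 1)) / 2) $ i $ j"
      unfolding sym_mats_polarization[OF sym] vec_lambda_beta
      by (intro tendsto_divide tendsto_diff tendsto_const q) simp
  qed
  from tendsto_sym_mats[OF sym this] this show ?thesis by (rule that)
qed

section \<open>Lyapunov theory of positive maps\<close>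

text \<open>
  Only linearity and the preservation of positive semidefinite matrices are used of the second-moment
  operators; the maps may change the dimension because the augmented system is larger than the state.
\<close>

definition positive_map :: "(real^'k^'k \<Rightarrow> real^'l^'l) \<Rightarrow> bool" where
  "positive_map L \<longleftrightarrow> linear L \<and> (\<forall>X. psd X \<longrightarrow> psd (L X))"

text \<open>
  Stability of \<open>L\<close> is certified by one such \<open>X\<close>, which replaces the spectral radius in all later
  arguments.
\<close>

definition lyapunov :: "(real^'k^'k \<Rightarrow> real^'k^'k) \<Rightarrow> real^'k^'k \<Rightarrow> bool" where
  "lyapunov L X \<longleftrightarrow> psd X \<and> posdef (X - L X)"

definition trace_adjoint :: "(real^'k^'k \<Rightarrow> real^'l^'l) \<Rightarrow> (real^'l^'l \<Rightarrow> real^'k^'k) \<Rightarrow> bool" where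
  "trace_adjoint L K \<longleftrightarrow> (\<forall>X Y. trace (L X ** Y) = trace (X ** K Y))"

lemma trace_adjointD: "trace_adjoint L K \<Longrightarrow> trace (L X ** Y) = trace (X ** K Y)"
  by (simp add: trace_adjoint_def)

lemma positive_map_simps:
  assumes "positive_map L"
  shows "L (X + Y) = L X + L Y" "L (X - Y) = L X - L Y" "L (c *\<^sub>R X) = c *\<^sub>R L X" "L 0 = 0"
  using assms by (simp_all add: positive_map_def linear_add linear_diff linear_cmul linear_0)

lemma positive_map_psd: "positive_map L \<Longrightarrow> psd X \<Longrightarrow> psd (L X)"
  by (simp add: positive_map_def)

lemma positive_map_mono: "positive_map L \<Longrightarrow> psd (Y - X) \<Longrightarrow> psd (L Y - L X)"
  by (metis positive_map_simps(2) positive_map_psd)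

text \<open>
  A symmetric matrix is a difference of the positive semidefinite matrices \<open>t I + X\<close> and \<open>t I\<close>.
\<close>

lemma positive_map_sym:
  assumes "positive_map L" "X \<in> sym_mats"
  shows "L X \<in> sym_mats"
proof -
  obtain t where "0 < t" "psd (t *\<^sub>R mat 1 - X)" "psd (t *\<^sub>R mat 1 + X)"
    by (rule sym_mats_le_scaled_id[OF assms(2)])
  then have "L (t *\<^sub>R mat 1 + X) \<in> sym_mats" "L (mat 1) \<in> sym_mats"
    by (intro psd_imp_sym positive_map_psd[OF assms(1)]; auto)+
  then have "L (t *\<^sub>R mat 1 + X) - t *\<^sub>R L (mat 1) \<in> sym_mats"
    by (intro sym_mats_intros)
  then show ?thesis by (simp add: positive_map_simps[OF assms(1)])
qed

lemma tendsto_positive_map: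
  assumes "positive_map L" "(X \<longlongrightarrow> S) F"
  shows "((\<lambda>k. L (X k)) \<longlongrightarrow> L S) F"
proof -
  have "bounded_linear L"
    using assms(1) by (simp add: positive_map_def linear_conv_bounded_linear)
  from bounded_linear.tendsto[OF this assms(2)] show ?thesis .
qed

lemma lyapunov_ge_scaled_id:
  assumes "positive_map L" "lyapunov L X"
  obtains e where "0 < e" "psd (X - L X - e *\<^sub>R mat 1)" "psd (X - e *\<^sub>R mat 1)"
proof -
  obtain e where e: "0 < e" "psd (X - L X - e *\<^sub>R mat 1)"
    using assms(2) posdef_ge_scaled_id[of "X - L X"] by (auto simp: lyapunov_def)
  have "psd ((X - L X - e *\<^sub>R mat 1) + L X)"
    using assms(2) by (intro psd_intros e positive_map_psd[OF assms(1)]) (simp add: lyapunov_def)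
  then show ?thesis using e that by simp
qed

text \<open>
  Since \<open>X\<close> is at most a multiple of \<open>X - L X\<close>, the map contracts it: \<open>L X \<le> \<rho> X\<close> with \<open>\<rho> < 1\<close>. Every
  symmetric \<open>Y\<close> lies between multiples \<open>\<plusminus> c X\<close>, and positivity of \<open>L\<close> carries both bounds along.
\<close>

lemma lyapunov_power_bound:
  assumes L: "positive_map L" and X: "lyapunov L X" and Y: "Y \<in> sym_mats"
  obtains c \<rho> where "0 \<le> c" "0 \<le> \<rho>" "\<rho> < 1"
    "\<And>k x. \<bar>qform ((L ^^ k) Y) x\<bar> \<le> c * \<rho> ^ k * qform X x"
proof -
  obtain e where e: "0 < e" "psd (X - L X - e *\<^sub>R mat 1)" "psd (X - e *\<^sub>R mat 1)"
    using lyapunov_ge_scaled_id[OF L X] .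
  have psdX: "psd X" using X by (simp add: lyapunov_def)
  obtain t where t: "0 < t" "psd (t *\<^sub>R mat 1 - X)" "psd (t *\<^sub>R mat 1 + X)"
    by (rule sym_mats_le_scaled_id[OF psd_imp_sym[OF psdX]])
  obtain s where s: "0 < s" "psd (s *\<^sub>R mat 1 - Y)" "psd (s *\<^sub>R mat 1 + Y)"
    by (rule sym_mats_le_scaled_id[OF Y])
  \<comment> \<open>Replacing the bound \<open>t\<close> by \<open>t + e\<close> makes \<open>\<rho> = 1 - e / (t + e)\<close> nonnegative.\<close>
  define \<rho> where "\<rho> = t / (t + e)"
  define c where "c = s / e"
  have contract: "psd (\<rho> *\<^sub>R X - L X)"
  proof (rule psdI)
    show "\<rho> *\<^sub>R X - L X \<in> sym_mats"
      using psdX positive_map_psd[OF L] by (auto intro: psd_imp_sym)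
    fix x
    have "qform (L X) x \<le> qform X x - e * (x \<bullet> x)"
      using psdD[OF e(2), of x] by simp
    moreover have "qform X x \<le> (t + e) * (x \<bullet> x)"
      using psdD[OF t(2), of x] e(1) by (simp add: algebra_simps add_increasing)
    then have "e * qform X x \<le> e * ((t + e) * (x \<bullet> x))"
      using e(1) by (intro mult_left_mono) auto
    then have "e / (t + e) * qform X x \<le> e * (x \<bullet> x)"
      using e(1) t(1) by (simp add: field_simps)
    moreover have "\<rho> * qform X x = qform X x - e / (t + e) * qform X x"
      using e(1) t(1) by (simp add: \<rho>_def field_simps)
    ultimately show "0 \<le> qform (\<rho> *\<^sub>R X - L X) x" by simp
  qed
  have \<rho>: "0 \<le> \<rho>" "\<rho> < 1" and c: "0 \<le> c" using e(1) t(1) s(1) by (simp_all add: \<rho>_def c_def)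
  have "psd ((c * \<rho> ^ k) *\<^sub>R X - (L ^^ k) T)" if "psd (s *\<^sub>R mat 1 - T)" for T k
  proof (induction k)
    case 0
    have "psd (c *\<^sub>R (X - e *\<^sub>R mat 1) + (s *\<^sub>R mat 1 - T))"
      using that e(3) c by (intro psd_intros)
    then show ?case using e(1) by (simp add: c_def algebra_simps)
  next
    case (Suc k)
    have "psd (L ((c * \<rho> ^ k) *\<^sub>R X - (L ^^ k) T) + (c * \<rho> ^ k) *\<^sub>R (\<rho> *\<^sub>R X - L X))"
      using positive_map_psd[OF L Suc] contract c \<rho> by (intro psd_intros) auto
    then show ?case by (simp add: positive_map_simps[OF L] algebra_simps)
  qed note bound = this
  have neg: "(L ^^ k) (- Y) = - ((L ^^ k) Y)" for k
    by (induction k) (use L in \<open>auto simp: positive_map_def linear_neg\<close>)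
  have "\<bar>qform ((L ^^ k) Y) x\<bar> \<le> c * \<rho> ^ k * qform X x" for k x
    using psdD[OF bound[of Y k], of x] psdD[OF bound[of "- Y" k], of x] s(2,3)
    by (simp add: neg abs_le_iff)
  then show ?thesis using that \<rho> c by blast
qed

text \<open>
  On an eigenvector \<open>u + \<i> v\<close> the \<open>k\<close>-th power acts as multiplication by \<open>c\<^sup>k\<close>, whereas both components
  decay geometrically; evaluating at a vector where the forms of \<open>u\<close> and \<open>v\<close> do not both vanish gives
  \<open>\<bar>c\<bar> < 1\<close>.
\<close>

lemma lyapunov_imp_spectrum_in_disc:
  assumes L: "positive_map L" and X: "lyapunov L X"
  shows "op_spectrum sym_mats L \<subseteq> ball 0 1"
proof
  fix c assume "c \<in> op_spectrum sym_mats L"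
  then obtain u v where uv: "u \<in> sym_mats" "v \<in> sym_mats" "u \<noteq> 0 \<or> v \<noteq> 0"
    and Lu: "L u = Re c *\<^sub>R u - Im c *\<^sub>R v" and Lv: "L v = Im c *\<^sub>R u + Re c *\<^sub>R v"
    by (auto simp: op_spectrum_def)
  obtain x where x: "qform u x \<noteq> 0 \<or> qform v x \<noteq> 0"
    using uv sym_mats_eqI[of u 0] sym_mats_eqI[of v 0] by (auto simp: sym_mats_intros)
  define \<zeta> where "\<zeta> = Complex (qform u x) (qform v x)"
  have "\<zeta> \<noteq> 0" using x by (simp add: \<zeta>_def complex_eq_iff)
  have pow: "(L ^^ k) u = Re (c ^ k) *\<^sub>R u - Im (c ^ k) *\<^sub>R v \<and>
             (L ^^ k) v = Im (c ^ k) *\<^sub>R u + Re (c ^ k) *\<^sub>R v" for k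
  proof (induction k)
    case (Suc k)
    have "(L ^^ Suc k) u = L (Re (c ^ k) *\<^sub>R u - Im (c ^ k) *\<^sub>R v)"
      and "(L ^^ Suc k) v = L (Im (c ^ k) *\<^sub>R u + Re (c ^ k) *\<^sub>R v)"
      using Suc by simp_all
    then show ?case
      by (simp add: positive_map_simps[OF L] Lu Lv algebra_simps)
  qed simp
  obtain a \<alpha> where a: "0 \<le> \<alpha>" "\<alpha> < 1" "\<And>k x. \<bar>qform ((L ^^ k) u) x\<bar> \<le> a * \<alpha> ^ k * qform X x"
    using lyapunov_power_bound[OF L X uv(1)] by metis
  obtain b \<beta> where b: "0 \<le> \<beta>" "\<beta> < 1" "\<And>k x. \<bar>qform ((L ^^ k) v) x\<bar> \<le> b * \<beta> ^ k * qform X x"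
    using lyapunov_power_bound[OF L X uv(2)] by metis
  have bound: "norm c ^ k * norm \<zeta> \<le> a * \<alpha> ^ k * qform X x + b * \<beta> ^ k * qform X x" for k
  proof -
    have "c ^ k * \<zeta> = Complex (qform ((L ^^ k) u) x) (qform ((L ^^ k) v) x)"
      by (simp add: pow \<zeta>_def complex_eq_iff)
    then have "norm c ^ k * norm \<zeta> = norm (Complex (qform ((L ^^ k) u) x) (qform ((L ^^ k) v) x))"
      by (metis norm_mult norm_power)
    also have "\<dots> \<le> \<bar>qform ((L ^^ k) u) x\<bar> + \<bar>qform ((L ^^ k) v) x\<bar>"
      using cmod_le by (metis complex.sel)
    also have "\<dots> \<le> a * \<alpha> ^ k * qform X x + b * \<beta> ^ k * qform X x"
      by (intro add_mono a b)
    finally show ?thesis .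
  qed
  have "norm c < 1"
  proof (rule ccontr)
    assume "\<not> norm c < 1"
    then have "norm \<zeta> \<le> norm c ^ k * norm \<zeta>" for k
      using mult_right_mono[OF one_le_power[of "norm c" k], of "norm \<zeta>"] by simp
    then have "norm \<zeta> \<le> a * \<alpha> ^ k * qform X x + b * \<beta> ^ k * qform X x" for k
      using bound order_trans by blast
    moreover have "(\<lambda>k. a * \<alpha> ^ k * qform X x + b * \<beta> ^ k * qform X x)
        \<longlonglongrightarrow> a * 0 * qform X x + b * 0 * qform X x"
      using a b by (intro tendsto_intros LIMSEQ_realpow_zero)
    ultimately have "norm \<zeta> \<le> 0"
      using LIMSEQ_le_const by fastforce
    then show False using \<open>\<zeta> \<noteq> 0\<close> by simp
  qed
  then show "c \<in> ball 0 1" by simp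
qed

lemma compact_psd_trace_1: "compact {X :: real^'k^'k. psd X \<and> trace X = 1}"
proof -
  have "norm X \<le> real (CARD('k) * CARD('k))" if "psd X" "trace X = 1" for X :: "real^'k^'k"
  proof -
    have q: "qform X (axis i 1) \<le> 1" for i
      using psd_le_trace[OF that(1), of "axis i 1"] that(2) by (simp add: inner_axis')
    have "\<bar>X $ i $ j\<bar> \<le> 1" for i j
    proof -
      have "(X $ i $ j)\<^sup>2 \<le> qform X (axis i 1) * qform X (axis j 1)"
        using psd_cauchy_schwarz[OF that(1)] nth_eq_inner_axis[of X i j] by metis
      also have "\<dots> \<le> 1 * 1"
        using q psdD[OF that(1)] by (intro mult_mono) auto
      finally show ?thesis by (simp add: abs_square_le_1)
    qed
    then have "(\<Sum>i\<in>UNIV. \<Sum>j\<in>UNIV. \<bar>X $ i $ j\<bar>) \<le> (\<Sum>i\<in>(UNIV::'k set). \<Sum>j\<in>(UNIV::'k set). 1)"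
      by (intro sum_mono)
    moreover have "norm X \<le> (\<Sum>i\<in>UNIV. norm (X $ i))"
      unfolding norm_vec_def by (rule L2_set_le_sum) simp
    moreover have "(\<Sum>i\<in>UNIV. norm (X $ i)) \<le> (\<Sum>i\<in>UNIV. \<Sum>j\<in>UNIV. \<bar>X $ i $ j\<bar>)"
      by (intro sum_mono norm_le_l1_cart)
    ultimately show ?thesis by simp
  qed
  then have "bounded {X :: real^'k^'k. psd X \<and> trace X = 1}"
    by (intro boundedI) blast
  moreover have "closed {X :: real^'k^'k. psd X \<and> trace X = 1}"
    unfolding closed_sequential_limits
  proof (intro allI impI, elim conjE)
    fix X and S :: "real^'k^'k"
    assume X: "\<forall>n. X n \<in> {X. psd X \<and> trace X = 1}" "X \<longlonglongrightarrow> S"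
    have "(\<lambda>n. trace (X n)) \<longlonglongrightarrow> trace S"
      unfolding trace_def by (intro tendsto_sum tendsto_vec_nth X(2))
    then have "trace S = 1" using X(1) by (simp add: LIMSEQ_const_iff)
    then show "S \<in> {X. psd X \<and> trace X = 1}"
      using tendsto_psd[of X S] X by simp
  qed
  ultimately show ?thesis by (simp add: compact_eq_bounded_closed)
qed

text \<open>
  A Perron-Frobenius argument. For \<open>e > 0\<close>, Brouwer's theorem on the positive semidefinite matrices
  of trace one gives \<open>X\<close> and \<open>\<lambda>\<close> with \<open>L X + e I = \<lambda> X\<close>. If \<open>\<lambda> < 1\<close> for some \<open>e\<close>, then \<open>X - L X \<ge> e I\<close>
  and \<open>X\<close> is the required matrix. Otherwise a limit point as \<open>e\<close> tends to \<open>0\<close> is an eigenvector of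
  \<open>L\<close> with eigenvalue at least \<open>1\<close>.
\<close>

lemma spectrum_in_disc_imp_lyapunov:
  fixes L :: "real^'k^'k \<Rightarrow> real^'k^'k"
  assumes L: "positive_map L" and spec: "op_spectrum sym_mats L \<subseteq> ball 0 1"
  obtains X where "lyapunov L X"
proof -
  let ?K = "{X :: real^'k^'k. psd X \<and> trace X = 1}"
  have contL: "continuous_on A L" for A
    using L by (auto simp: positive_map_def linear_conv_bounded_linear intro: linear_continuous_on)
  have cont_trace: "continuous_on A (\<lambda>X :: real^'k^'k. trace (f X))"
    if "continuous_on A f" for A and f :: "real^'k^'k \<Rightarrow> real^'k^'k"
    unfolding trace_def by (intro continuous_intros that)
  have fixpoint: "\<exists>X\<in>?K. L X + e *\<^sub>R mat 1 = trace (L X + e *\<^sub>R mat 1) *\<^sub>R X" if "e > 0" for e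
  proof -
    define g where "g X = L X + e *\<^sub>R mat 1" for X
    have psd_g: "psd (g X)" and tr_g: "trace (g X) > 0" if "psd X" for X
    proof -
      show "psd (g X)"
        unfolding g_def using positive_map_psd[OF L that] \<open>e > 0\<close> by (intro psd_intros) auto
      have "trace (L X) \<ge> 0" using positive_map_psd[OF L that] by (rule psd_trace_nonneg)
      then show "trace (g X) > 0"
        using \<open>e > 0\<close> by (simp add: g_def trace_add trace_scaleR trace_I add_nonneg_pos)
    qed
    have contg: "continuous_on ?K g"
      unfolding g_def by (intro continuous_intros contL)
    define h where "h X = (1 / trace (g X)) *\<^sub>R g X" for X
    have cont: "continuous_on ?K h"
      unfolding h_def using tr_g by (intro continuous_intros contg cont_trace) force
    have maps: "h \<in> ?K \<rightarrow> ?K"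
    proof
      fix X assume "X \<in> ?K"
      then have X: "psd X" by simp
      have "psd (h X)"
        unfolding h_def using tr_g[OF X] by (intro psd_intros psd_g[OF X]) simp
      then show "h X \<in> ?K"
        using tr_g[OF X] by (simp add: h_def trace_scaleR)
    qed
    have conv: "convex ?K"
      by (intro convexI) (auto simp: trace_add trace_scaleR)
    have "(1 / of_nat CARD('k)) *\<^sub>R mat 1 \<in> ?K"
      by (auto simp: trace_scaleR trace_I)
    then have ne: "?K \<noteq> {}" by blast
    obtain X where X: "X \<in> ?K" "h X = X"
      by (rule brouwer[OF compact_psd_trace_1 conv ne cont maps])
    have "trace (g X) *\<^sub>R h X = g X"
      using tr_g[of X] X(1) by (simp add: h_def)
    then show ?thesis using X by (auto simp: g_def)
  qed
  show ?thesis
  proof (cases "\<exists>e>0. \<exists>X\<in>?K. L X + e *\<^sub>R mat 1 = trace (L X + e *\<^sub>R mat 1) *\<^sub>R X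
      \<and> trace (L X + e *\<^sub>R mat 1) < 1")
    case True
    then obtain e X l where e: "e > 0" and X: "psd X" and l: "L X + e *\<^sub>R mat 1 = l *\<^sub>R X" "l < 1"
      by auto
    have "X - L X - e *\<^sub>R mat 1 = (1 - l) *\<^sub>R X"
      using l(1) by (simp add: algebra_simps)
    then have "psd (X - L X - e *\<^sub>R mat 1)"
      using l(2) X by (auto intro: psd_intros)
    from X psd_ge_scaled_id_imp_posdef[OF e this] have "lyapunov L X"
      by (simp add: lyapunov_def)
    then show ?thesis by (rule that)
  next
    case False
    define e where "e n = inverse (real (Suc n))" for n
    define T where "T n X = L X + e n *\<^sub>R mat 1" for n and X
    have "\<exists>X. X \<in> ?K \<and> T n X = trace (T n X) *\<^sub>R X \<and> 1 \<le> trace (T n X)" for n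
    proof -
      have "e n > 0" by (simp add: e_def)
      from fixpoint[OF this] obtain X where X: "X \<in> ?K" "T n X = trace (T n X) *\<^sub>R X"
        by (auto simp: T_def)
      with False \<open>e n > 0\<close> have "\<not> trace (T n X) < 1" unfolding T_def by blast
      with X show ?thesis by (intro exI[of _ X]) simp
    qed
    then have "\<forall>n. \<exists>X. X \<in> ?K \<and> T n X = trace (T n X) *\<^sub>R X \<and> 1 \<le> trace (T n X)"
      by (rule allI)
    from choice[OF this] obtain X where X: "\<forall>n. X n \<in> ?K \<and>
        T n (X n) = trace (T n (X n)) *\<^sub>R X n \<and> 1 \<le> trace (T n (X n))" ..
    have seq: "seq_compact ?K" by (rule compact_imp_seq_compact[OF compact_psd_trace_1])
    have in_K: "\<forall>n. X n \<in> ?K" using X by simp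
    obtain S r where S: "S \<in> ?K" and r: "strict_mono (r :: nat \<Rightarrow> nat)"
      and XS: "(X \<circ> r) \<longlonglongrightarrow> S"
      by (rule seq_compactE[OF seq in_K])
    have XS: "(\<lambda>n. X (r n)) \<longlonglongrightarrow> S" using XS by (simp add: o_def)
    have "(\<lambda>n. e (r n)) \<longlonglongrightarrow> 0"
      using LIMSEQ_subseq_LIMSEQ[OF LIMSEQ_inverse_real_of_nat r] by (simp add: o_def e_def)
    then have "(\<lambda>n. L (X (r n)) + e (r n) *\<^sub>R mat 1) \<longlonglongrightarrow> L S + 0 *\<^sub>R mat 1"
      by (intro tendsto_add tendsto_scaleR tendsto_const tendsto_positive_map[OF L] XS)
    then have lim: "(\<lambda>n. T (r n) (X (r n))) \<longlonglongrightarrow> L S" by (simp add: T_def)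
    have lim_tr: "(\<lambda>n. trace (T (r n) (X (r n)))) \<longlonglongrightarrow> trace (L S)"
      unfolding trace_def by (intro tendsto_sum tendsto_vec_nth lim)
    have "(\<lambda>n. trace (T (r n) (X (r n))) *\<^sub>R X (r n)) \<longlonglongrightarrow> trace (L S) *\<^sub>R S"
      by (intro tendsto_scaleR lim_tr XS)
    moreover have "trace (T (r n) (X (r n))) *\<^sub>R X (r n) = T (r n) (X (r n))" for n
      using X by simp
    ultimately have "(\<lambda>n. T (r n) (X (r n))) \<longlonglongrightarrow> trace (L S) *\<^sub>R S" by simp
    from LIMSEQ_unique[OF lim this] have eig: "L S = trace (L S) *\<^sub>R S" .
    have ge: "1 \<le> trace (L S)"
      using X by (intro LIMSEQ_le_const[OF lim_tr]) blast
    have S0: "S \<noteq> 0" "S \<in> sym_mats" using S by (auto simp: psd_imp_sym)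
    have "complex_of_real (trace (L S)) \<in> op_spectrum sym_mats L"
      unfolding op_spectrum_def
    proof (intro CollectI bexI conjI)
      show "S \<noteq> 0 \<or> (0 :: real^'k^'k) \<noteq> 0" using S0 by simp
      show "L S = Re (complex_of_real (trace (L S))) *\<^sub>R S - Im (complex_of_real (trace (L S))) *\<^sub>R 0"
        using eig by simp
      show "L 0 = Im (complex_of_real (trace (L S))) *\<^sub>R S + Re (complex_of_real (trace (L S))) *\<^sub>R 0"
        by (simp add: positive_map_simps(4)[OF L])
    qed (use S0 in \<open>simp_all add: sym_mats_intros\<close>)
    then have "norm (complex_of_real (trace (L S))) < 1" using spec by auto
    then show ?thesis using ge by simp
  qed
qed

lemma positive_map_iterates:
  fixes K :: "real^'k^'k \<Rightarrow> real^'k^'k"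
  assumes K: "positive_map K" and V: "psd V"
  shows "psd (((\<lambda>X. K X + V) ^^ k) 0)"
    and "psd (((\<lambda>X. K X + V) ^^ Suc k) 0 - ((\<lambda>X. K X + V) ^^ k) 0)"
proof -
  show "psd (((\<lambda>X. K X + V) ^^ k) 0)"
  proof (induction k)
    case (Suc k)
    show ?case using psd_intros(3)[OF positive_map_psd[OF K Suc] V] by simp
  qed (simp add: psd_intros(1))
  show "psd (((\<lambda>X. K X + V) ^^ Suc k) 0 - ((\<lambda>X. K X + V) ^^ k) 0)"
  proof (induction k)
    case 0
    then show ?case using V by (simp add: positive_map_simps[OF K])
  next
    case (Suc k)
    then show ?case using positive_map_mono[OF K Suc] by simp
  qed
qed

text \<open>
  The iterates from \<open>0\<close> are increasing, so a bound on their forms is enough for convergence, and the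
  limit solves the equation by continuity.
\<close>

lemma positive_map_fixpoint:
  assumes K: "positive_map K" and V: "psd V"
    and bound: "\<And>k x. qform (((\<lambda>X. K X + V) ^^ k) 0) x \<le> b x"
  obtains Y where "psd Y" "Y = K Y + V"
proof -
  define S where "S k = ((\<lambda>X. K X + V) ^^ k) 0" for k
  have S_Suc: "S (Suc k) = K (S k) + V" for k by (simp add: S_def)
  have psdS: "psd (S k)" and mono: "psd (S (Suc k) - S k)" for k
    unfolding S_def by (rule positive_map_iterates[OF K V])+
  obtain Y where Y: "S \<longlonglongrightarrow> Y"
    using psd_incseq_convergent[of S b] psd_imp_sym[OF psdS] mono bound unfolding S_def by metis
  have "(\<lambda>k. S (Suc k)) \<longlonglongrightarrow> K Y + V"
    unfolding S_Suc by (intro tendsto_intros tendsto_positive_map[OF K] Y)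
  then have "Y = K Y + V"
    using LIMSEQ_Suc[OF Y] LIMSEQ_unique by blast
  then show ?thesis using that tendsto_psd[of S Y] psdS Y by blast
qed

text \<open>
  A multiple of the Lyapunov matrix is a supersolution of the equation and bounds the iterates.
\<close>

lemma lyapunov_equation_solvable:
  assumes L: "positive_map L" and X: "lyapunov L X" and V: "psd V"
  obtains Y where "psd Y" "Y = L Y + V"
proof -
  obtain e where e: "0 < e" "psd (X - L X - e *\<^sub>R mat 1)" "psd (X - e *\<^sub>R mat 1)"
    using lyapunov_ge_scaled_id[OF L X] .
  obtain t where t: "0 < t" "psd (t *\<^sub>R mat 1 - V)" "psd (t *\<^sub>R mat 1 + V)"
    by (rule sym_mats_le_scaled_id[OF psd_imp_sym[OF V]])
  have "psd ((t / e) *\<^sub>R (X - L X - e *\<^sub>R mat 1) + (t *\<^sub>R mat 1 - V))"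
    using e t by (intro psd_intros) auto
  then have step: "psd ((t / e) *\<^sub>R (X - L X) - V)"
    using e(1) by (simp add: algebra_simps)
  have "psd ((t / e) *\<^sub>R X - ((\<lambda>X. L X + V) ^^ k) 0)" for k
  proof (induction k)
    case 0
    then show ?case using X e(1) t(1) by (auto simp: lyapunov_def)
  next
    case (Suc k)
    have "psd (L ((t / e) *\<^sub>R X - ((\<lambda>X. L X + V) ^^ k) 0) + ((t / e) *\<^sub>R (X - L X) - V))"
      using positive_map_psd[OF L Suc] step by blast
    then show ?case by (simp add: positive_map_simps[OF L] algebra_simps)
  qed
  then have "qform (((\<lambda>X. L X + V) ^^ k) 0) x \<le> qform ((t / e) *\<^sub>R X) x" for k x
    using psdD by fastforce
  then show ?thesis by (rule positive_map_fixpoint[OF L V]) (rule that)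
qed

text \<open>
  Here the Lyapunov matrix belongs to the adjoint of the iterated map, so it bounds traces instead of
  the matrices themselves: pairing \<open>X - L X \<ge> e I\<close> with the increasing iterates \<open>S\<^sub>k\<close> gives
  \<open>e trace S\<^sub>k \<le> trace (X Z)\<close>.
\<close>

lemma adjoint_lyapunov_equation_solvable:
  assumes L: "positive_map L" and X: "lyapunov L X"
    and K: "positive_map K" and adj: "trace_adjoint L K" and Z: "psd Z"
  obtains Y where "psd Y" "Y = K Y + Z"
proof -
  obtain e where e: "0 < e" "psd (X - L X - e *\<^sub>R mat 1)" "psd (X - e *\<^sub>R mat 1)"
    using lyapunov_ge_scaled_id[OF L X] .
  have psdX: "psd X" using X by (simp add: lyapunov_def)
  define S where "S k = ((\<lambda>X. K X + Z) ^^ k) 0" for k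
  have S_Suc: "S (Suc k) = K (S k) + Z" for k by (simp add: S_def)
  have psdS: "psd (S k)" and mono: "psd (S (Suc k) - S k)" for k
    unfolding S_def by (rule positive_map_iterates[OF K Z])+
  have tr: "trace (S k) \<le> trace (X ** Z) / e" for k
  proof -
    have "0 \<le> trace ((X - L X - e *\<^sub>R mat 1) ** S k)"
        by (intro trace_mult_nonneg e(2) psdS)
    also have "\<dots> = trace (X ** S k) - trace (X ** K (S k)) - e * trace (S k)"
      by (simp add: matrix_mul_simps trace_sub trace_adjointD[OF adj] trace_scaleR
          flip: scalar_matrix_assoc)
    also have "trace (X ** S k) - trace (X ** K (S k)) = trace (X ** Z) - trace (X ** (S (Suc k) - S k))"
      by (simp add: S_Suc matrix_mul_simps trace_sub trace_add)
    also have "\<dots> \<le> trace (X ** Z)"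
      using trace_mult_nonneg[OF psdX mono] by simp
    finally show ?thesis using e(1) by (simp add: field_simps)
  qed
  have "qform (S k) x \<le> trace (X ** Z) / e * (x \<bullet> x)" for k x
    using psd_le_trace[OF psdS, of k x] mult_right_mono[OF tr[of k], of "x \<bullet> x"] by simp
  then have "qform (((\<lambda>X. K X + Z) ^^ k) 0) x \<le> trace (X ** Z) / e * (x \<bullet> x)" for k x
    by (simp add: S_def)
  then show ?thesis by (rule positive_map_fixpoint[OF K Z]) (rule that)
qed

text \<open>
  Solving \<open>P = L P + v v\<^sup>T\<close> with \<open>P \<ge> 0\<close> expresses the form of \<open>Y\<close> at \<open>v\<close> by duality as \<open>trace (P Z)\<close>.
\<close>

lemma adjoint_lyapunov_equation_psd:
  assumes L: "positive_map L" and X: "lyapunov L X"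
    and adj: "trace_adjoint L K" and Z: "psd Z"
    and Y: "Y \<in> sym_mats" "Y = K Y + Z"
  shows "psd Y"
proof (rule psdI[OF Y(1)])
  fix v
  obtain P where P: "psd P" "P = L P + outer_prod v v"
    using lyapunov_equation_solvable[OF L X psd_outer_prod] .
  have "qform Y v = trace (outer_prod v v ** Y)" by (simp add: trace_outer_prod_mult)
  also have "outer_prod v v = P - L P" using P(2) by (metis add_diff_cancel_left')
  also have "trace ((P - L P) ** Y) = trace (P ** (Y - K Y))"
    by (simp add: matrix_mul_simps trace_sub trace_adjointD[OF adj])
  also have "Y - K Y = Z" using Y(2) by (metis add_diff_cancel_left')
  finally show "0 \<le> qform Y v" using trace_mult_nonneg[OF P(1) Z] by simp
qed

text \<open>
  The duality that prices a feasible point: \<open>C \<le> X - L X\<close> is paired with \<open>Y\<close>, and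
  \<open>trace ((X - L X) Y) = trace (X Z)\<close>.
\<close>

lemma adjoint_lyapunov_equation_cost:
  assumes adj: "trace_adjoint L K" and Y: "psd Y" "Y = K Y + Z"
    and C: "psd (X - (L X + C))"
  shows "trace (C ** Y) \<le> trace (X ** Z)"
proof -
  have "0 \<le> trace ((X - (L X + C)) ** Y)" by (rule trace_mult_nonneg[OF C Y(1)])
  also have "\<dots> = trace (X ** (Y - K Y)) - trace (C ** Y)"
    by (simp add: matrix_mul_simps trace_sub trace_add trace_adjointD[OF adj])
  also have "Y - K Y = Z" using Y(2) by (metis add_diff_cancel_left')
  finally show ?thesis by simp
qed

section \<open>Sums of three congruences\<close>

text \<open>
  The common shape of all second-moment operators of the problem; their adjoints have the same shape
  with transposed matrices.
\<close>

definition cong3 ::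
  "real^'p^'q \<Rightarrow> real^'p^'q \<Rightarrow> real^'p^'q \<Rightarrow> real^'q^'q \<Rightarrow> real^'p^'p" where
  "cong3 A B C X =
     transpose A ** X ** A + transpose B ** X ** B + transpose C ** X ** C"

lemma qform_cong3: "qform (cong3 A B C X) x = qform X (A *v x) + qform X (B *v x) + qform X (C *v x)"
  by (simp add: cong3_def qform_congruence)

lemma matrix_scaleR_simps:
  "(c *\<^sub>R A) ** (B :: real^'p^'q) = c *\<^sub>R (A ** B)"
  "(B :: real^'p^'q) ** (c *\<^sub>R D) = c *\<^sub>R (B ** D)"
  by (simp_all add: matrix_matrix_mult_def vec_eq_iff sum_distrib_left mult_ac)

lemma trace_sum_mult: "trace ((\<Sum>l\<in>I. f l) ** S) = (\<Sum>l\<in>I. trace (f l ** (S :: real^'p^'p)))"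
  by (rule linear_sum, rule linearI)
     (simp_all add: matrix_mul_simps matrix_scaleR_simps trace_add trace_scaleR)

lemma positive_map_cong3: "positive_map (cong3 A B C)"
  unfolding positive_map_def
proof (intro conjI allI impI)
  show "linear (cong3 A B C)"
    by (rule linearI) (simp_all add: cong3_def matrix_mul_simps matrix_scaleR_simps algebra_simps)
  show "psd (cong3 A B C X)" if "psd X" for X
    unfolding cong3_def using that by (intro psd_intros)
qed

lemma trace_congruence:
  "trace (transpose A ** X ** A ** Y) = trace (X ** (A ** Y ** transpose (A :: real^'p^'q)))"
  using trace_mul_sym[of "transpose A" "X ** A ** Y"] by (simp add: matrix_mul_assoc)

lemma trace_adjoint_cong3:
  "trace_adjoint (cong3 A B C) (cong3 (transpose A) (transpose B) (transpose C))"
  by (simp add: trace_adjoint_def cong3_def matrix_mul_simps trace_add trace_congruence)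

lemma cong3_mult:
  "cong3 (A ** G) (B ** G) (C ** G) X = transpose G ** cong3 A B C X ** G"
  by (simp add: cong3_def matrix_mul_simps matrix_transpose_mul matrix_mul_assoc)

lemma cong3_transpose_mult:
  "cong3 (transpose (G ** A)) (transpose (G ** B)) (transpose (G ** C)) X =
     G ** cong3 (transpose A) (transpose B) (transpose C) X ** transpose G"
  by (simp add: cong3_def matrix_mul_simps matrix_transpose_mul matrix_mul_assoc)

section \<open>Block matrices\<close>

lemma vec_append_nth [simp]:
  "vec_append v w $ Inl a = v $ a" "vec_append v w $ Inr b = w $ b"
  by (simp_all add: vec_append_def)

lemma all_sum_type: "(\<forall>i. P i) \<longleftrightarrow> (\<forall>a. P (Inl a)) \<and> (\<forall>b. P (Inr b))"
  by (metis sum.exhaust)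

lemma sum_sum_type:
  "(\<Sum>i\<in>UNIV. f i) = (\<Sum>a\<in>UNIV. f (Inl a)) + (\<Sum>b\<in>UNIV. f (Inr b))"
  for f :: "'a::finite + 'b::finite \<Rightarrow> 'c::comm_monoid_add"
  by (simp add: sum.Plus[OF finite finite, of f UNIV UNIV] o_def flip: UNIV_Plus_UNIV)

lemma vec_append_cases:
  obtains x y where "v = vec_append x (y :: 'a^'q)"
proof -
  have "v = vec_append (\<chi> a. v $ Inl a) (\<chi> b. v $ Inr b)"
    by (simp add: vec_eq_iff all_sum_type)
  then show ?thesis by (rule that)
qed

lemma vec_append_add: "vec_append x y + vec_append u v = vec_append (x + u) (y + v :: real^'q)"
  by (simp add: vec_eq_iff all_sum_type)

lemma vec_append_zero: "vec_append 0 0 = (0 :: real^('p::finite + 'q::finite))"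
  by (simp add: vec_eq_iff all_sum_type)

lemma inner_vec_append: "vec_append x y \<bullet> vec_append u v = x \<bullet> u + y \<bullet> v"
  by (simp add: inner_vec_def sum_sum_type)

definition hcat :: "real^'c^'a \<Rightarrow> real^'d^'a \<Rightarrow> real^('c + 'd)^'a" where
  "hcat A B = (\<chi> i. vec_append (A $ i) (B $ i))"

lemma hcat_nth [simp]: "hcat A B $ i = vec_append (A $ i) (B $ i)"
  by (simp add: hcat_def)

lemma block_mat_hcat: "block_mat A B C D = vec_append (hcat A B) (hcat C D)"
  by (simp add: block_mat_def hcat_def)

lemma block_mat_nth [simp]:
  "block_mat A B C D $ Inl i = vec_append (A $ i) (B $ i)"
  "block_mat A B C D $ Inr j = vec_append (C $ j) (D $ j)"
  by (simp_all add: block_mat_hcat)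

lemma vec_append_mult: "vec_append A B ** C = vec_append (A ** C) (B ** C)"
  by (simp add: matrix_matrix_mult_def vec_eq_iff all_sum_type)

lemma mult_hcat: "A ** hcat B C = hcat (A ** B) (A ** C)"
  by (simp add: matrix_matrix_mult_def vec_eq_iff all_sum_type)

lemma hcat_mult_vec_append: "hcat A B ** vec_append C D = A ** C + B ** D"
  by (simp add: matrix_matrix_mult_def vec_eq_iff sum_sum_type)

lemma block_mat_mult:
  "block_mat A B C D ** block_mat A' B' C' D' =
     block_mat (A ** A' + B ** C') (A ** B' + B ** D') (C ** A' + D ** C') (C ** B' + D ** D')"
  by (simp add: matrix_matrix_mult_def vec_eq_iff all_sum_type sum_sum_type)

lemma block_mat_vec_append:
  "block_mat A B C D *v vec_append x y = vec_append (A *v x + B *v y) (C *v x + D *v y)"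
  by (simp add: matrix_vector_mult_def vec_eq_iff all_sum_type sum_sum_type)

lemma vec_append_matrix_vector: "vec_append A B *v x = vec_append (A *v x) (B *v x)"
  by (simp add: matrix_vector_mult_def vec_eq_iff all_sum_type)

lemma transpose_block_mat:
  "transpose (block_mat A B C D) = block_mat (transpose A) (transpose C) (transpose B) (transpose D)"
  by (simp add: transpose_def vec_eq_iff all_sum_type)

lemma transpose_vec_append: "transpose (vec_append A B) = hcat (transpose A) (transpose B)"
  by (simp add: transpose_def vec_eq_iff all_sum_type)

lemma block_mat_add:
  "block_mat A B C D + block_mat A' B' C' D' = block_mat (A + A') (B + B') (C + C') (D + D')"
  by (simp add: vec_eq_iff all_sum_type)

lemma block_mat_scaleR:
  "c *\<^sub>R block_mat A B C D = block_mat (c *\<^sub>R A) (c *\<^sub>R B) (c *\<^sub>R C) (c *\<^sub>R D)"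
  by (simp add: vec_eq_iff all_sum_type)

lemma block_mat_cases:
  obtains A B C D where "M = block_mat A B C (D :: real^'d^'b)"
proof -
  have "M = block_mat (\<chi> i j. M $ Inl i $ Inl j) (\<chi> i j. M $ Inl i $ Inr j)
      (\<chi> i j. M $ Inr i $ Inl j) (\<chi> i j. M $ Inr i $ Inr j)"
    by (simp add: vec_eq_iff all_sum_type)
  then show ?thesis by (rule that)
qed

lemma matrix_mult_zero [simp]:
  "(0 :: real^'p^'q) ** A = 0" "(B :: real^'p^'q) ** 0 = 0"
  by (simp_all add: matrix_matrix_mult_def vec_eq_iff)

lemmas block_simps = block_diag_def block_mat_mult transpose_block_mat block_mat_add block_mat_scaleR
  transpose_zero

lemma block_diag_vec_append: "block_diag A D *v vec_append x y = vec_append (A *v x) (D *v y)"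
  by (simp add: block_diag_def block_mat_vec_append)

lemma qform_block_diag: "qform (block_diag A D) (vec_append x y) = qform A x + qform D y"
  by (simp add: qform_def block_diag_vec_append inner_vec_append)

lemma trace_block_diag_mult:
  "trace (block_diag A D ** block_diag A' D') = trace (A ** A') + trace (D ** D')"
  by (simp add: trace_def sum_sum_type block_simps)

lemma block_diag_sym: "block_diag A D \<in> sym_mats \<longleftrightarrow> A \<in> sym_mats \<and> D \<in> sym_mats"
  by (auto simp: sym_mats_def block_simps vec_eq_iff all_sum_type)

lemma psd_block_diag: "psd A \<Longrightarrow> psd D \<Longrightarrow> psd (block_diag A D)"
  unfolding psd_iff block_diag_sym by (metis add_nonneg_nonneg qform_block_diag vec_append_cases)

lemma posdef_block_diag: "posdef A \<Longrightarrow> posdef D \<Longrightarrow> posdef (block_diag A D)"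
  unfolding posdef_iff block_diag_sym
proof (elim conjE, intro conjI allI impI)
  fix v :: "real^('a + 'b)"
  assume AD: "\<forall>x. x \<noteq> 0 \<longrightarrow> 0 < qform A x" "\<forall>x. x \<noteq> 0 \<longrightarrow> 0 < qform D x" and "v \<noteq> 0"
  obtain x y where v: "v = vec_append x y" by (rule vec_append_cases)
  have "0 \<le> qform A x" "0 \<le> qform D y"
    using AD by (metis inner_zero_left less_eq_real_def qform_def)+
  moreover have "x \<noteq> 0 \<or> y \<noteq> 0" using \<open>v \<noteq> 0\<close> v vec_append_zero by blast
  ultimately show "0 < qform (block_diag A D) v"
    using AD by (auto simp: v qform_block_diag intro: add_pos_nonneg add_nonneg_pos)
qed

text \<open>
  Completing the square in \<open>u\<close>: the minimizer solves \<open>H\<^sub>u\<^sub>x x + H\<^sub>u\<^sub>u u = 0\<close>, hence depends linearly on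
  \<open>x\<close>, and one matrix \<open>K\<close> is optimal for all \<open>x\<close> at once.
\<close>

lemma quadratic_minimizer:
  fixes H :: "real^('n::finite + 'm::finite)^('n + 'm)"
  assumes sym: "H \<in> sym_mats" and pos: "\<And>u. u \<noteq> 0 \<Longrightarrow> 0 < qform H (vec_append 0 u)"
  obtains K :: "real^'n^'m"
  where "\<And>x u. qform H (vec_append x (K *v x)) \<le> qform H (vec_append x u)"
proof -
  obtain Hxx Hxu Hux Huu where H: "H = block_mat Hxx Hxu Hux (Huu :: real^'m^'m)"
    by (rule block_mat_cases)
  have quu: "qform H (vec_append 0 u) = qform Huu u" for u
    by (simp add: H qform_def block_mat_vec_append inner_vec_append)
  have "u = 0" if "Huu *v u = 0" for u
    using pos[of u] quu[of u] that by (auto simp: qform_def)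
  then have "invertible Huu"
    by (simp add: invertible_left_inverse matrix_left_invertible_ker)
  then obtain B where B: "Huu ** B = mat 1" by (auto simp: invertible_def)
  define K where "K = - (B ** Hux)"
  have "Huu ** K = - Hux"
    using matrix_mul_simps(1)[of Huu 0 "B ** Hux"] by (simp add: K_def matrix_mul_assoc B)
  then have stationary: "Hux *v x + Huu *v (K *v x) = 0" for x
    using matrix_vector_mult_add_rdistrib[of Hux "- Hux" x] by (simp add: matrix_vector_mul_assoc)
  have "qform H (vec_append x (K *v x)) \<le> qform H (vec_append x u)" for x u
  proof -
    define d where "d = u - K *v x"
    have "vec_append x u = vec_append 0 d + vec_append x (K *v x)"
      by (simp add: vec_append_add d_def)
    then have "qform H (vec_append x u) = qform H (vec_append 0 d)
        + 2 * (vec_append 0 d \<bullet> (H *v vec_append x (K *v x))) + qform H (vec_append x (K *v x))"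
      by (simp add: qform_add_vec[OF sym])
    moreover have "vec_append 0 d \<bullet> (H *v vec_append x (K *v x)) = 0"
      by (simp add: H block_mat_vec_append inner_vec_append stationary)
    moreover have "0 \<le> qform H (vec_append 0 d)"
      using pos[of d] by (cases "d = 0") (simp_all add: vec_append_zero qform_def)
    ultimately show ?thesis by simp
  qed
  then show ?thesis by (rule that)
qed

section \<open>Factorization of the closed loop through the gain\<close>

text \<open>
  It maps the mean and the deviation of the state to the mean and the deviation of state and control
  under the feedback.
\<close>

definition gain_mat :: "real^'n^'m \<Rightarrow> real^'n^'m \<Rightarrow> real^('n + 'n)^(('n + 'm) + ('n + 'm))" where
  "gain_mat F Fbar = block_diag (vec_append (mat 1) (F + Fbar)) (vec_append (mat 1) F)"

text \<open>
  The matrices \<open>open_A1\<close>, \<open>open_A2\<close>, \<open>open_A3\<close> map mean and deviation of state and control to the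
  successor state: the noise-free part, and the noisy parts driven by the deviation and by the mean.
  They do not depend on the feedback.
\<close>

definition open_A1 :: "('n::finite, 'm::finite) mf_system \<Rightarrow> real^(('n + 'm) + ('n + 'm))^('n + 'n)" where
  "open_A1 sys = block_diag (hcat (A1hat sys) (B1hat sys)) (hcat (A1 sys) (B1 sys))"

definition open_A2 :: "('n::finite, 'm::finite) mf_system \<Rightarrow> real^(('n + 'm) + ('n + 'm))^('n + 'n)" where
  "open_A2 sys = block_diag 0 (hcat (A2 sys) (B2 sys))"

definition open_A3 :: "('n::finite, 'm::finite) mf_system \<Rightarrow> real^(('n + 'm) + ('n + 'm))^('n + 'n)" where
  "open_A3 sys = block_mat 0 0 (hcat (A2hat sys) (B2hat sys)) 0"

lemma cal_eq_open_gain: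
  "cal_A1 sys F Fbar = open_A1 sys ** gain_mat F Fbar"
  "cal_A2 sys F = open_A2 sys ** gain_mat F Fbar"
  "cal_A3 sys F Fbar = open_A3 sys ** gain_mat F Fbar"
  by (simp_all add: cal_A1_def cal_A2_def cal_A3_def open_A1_def open_A2_def open_A3_def
      gain_mat_def block_simps hcat_mult_vec_append)

lemma hcat_vec_append: "hcat (vec_append A B) (vec_append C D) = block_mat A C B D"
  by (simp add: vec_eq_iff all_sum_type)

lemma vec_append_mult_hcat:
  "vec_append A B ** hcat C D = block_mat (A ** C) (A ** D) (B ** C) (B ** D)"
  by (simp add: vec_append_mult mult_hcat hcat_vec_append)

lemma aug_block_eq: "aug_block A B K = vec_append (mat 1) K ** hcat A B"
  by (simp add: aug_block_def vec_append_mult_hcat)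

text \<open>
  The two families of closed-loop matrices are products of the same factors in opposite orders, which
  is why a feasible \<open>S\<close> and a solution of the Lyapunov equation on the smaller state space determine
  each other.
\<close>

lemma aug_eq_gain_open:
  "aug_A1 sys F Fbar = gain_mat F Fbar ** open_A1 sys"
  "aug_A2 sys F = gain_mat F Fbar ** open_A2 sys"
  "aug_A3 sys F = gain_mat F Fbar ** open_A3 sys"
  by (simp_all add: aug_A1_def aug_A2_def aug_A3_def open_A1_def open_A2_def open_A3_def
      gain_mat_def block_simps aug_block_eq)

lemma vec_append_congruence:
  "vec_append G 0 ** Z ** transpose (vec_append G 0) = block_diag (G ** Z ** transpose G) 0"
  "vec_append 0 G ** Z ** transpose (vec_append 0 G) = block_diag 0 (G ** Z ** transpose G)"
  by (simp_all add: vec_append_mult transpose_vec_append mult_hcat block_diag_def transpose_zero)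
     (simp_all add: vec_eq_iff all_sum_type)

lemma init_term_eq_gain:
  "init_term F Fbar Z1 Z2 =
     gain_mat F Fbar ** block_diag Z2 (Z1 - Z2) ** transpose (gain_mat F Fbar)"
proof -
  have "gain_mat F Fbar ** block_diag Z2 (Z1 - Z2) ** transpose (gain_mat F Fbar) =
      block_diag (vec_append (mat 1) (F + Fbar) ** Z2 ** transpose (vec_append (mat 1) (F + Fbar)))
        (vec_append (mat 1) F ** (Z1 - Z2) ** transpose (vec_append (mat 1) F))"
    by (simp only: gain_mat_def block_simps matrix_mult_zero add_0_left add_0_right)
  then show ?thesis
    by (simp add: init_term_def FF1_def FF2_def vec_append_congruence)
       (simp add: block_diag_def block_mat_add)
qed

definition closed_loop_map :: "('n::finite, 'm::finite) mf_system \<Rightarrow> real^'n^'m \<Rightarrow> real^'n^'m \<Rightarrow>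
    real^('n + 'n)^('n + 'n) \<Rightarrow> real^('n + 'n)^('n + 'n)" where
  "closed_loop_map sys F Fbar = cong3 (cal_A1 sys F Fbar) (cal_A2 sys F) (cal_A3 sys F Fbar)"

definition closed_loop_adj :: "('n::finite, 'm::finite) mf_system \<Rightarrow> real^'n^'m \<Rightarrow> real^'n^'m \<Rightarrow>
    real^('n + 'n)^('n + 'n) \<Rightarrow> real^('n + 'n)^('n + 'n)" where
  "closed_loop_adj sys F Fbar =
     cong3 (transpose (cal_A1 sys F Fbar)) (transpose (cal_A2 sys F)) (transpose (cal_A3 sys F Fbar))"

definition open_loop_map :: "('n::finite, 'm::finite) mf_system \<Rightarrow>
    real^('n + 'n)^('n + 'n) \<Rightarrow> real^(('n + 'm) + ('n + 'm))^(('n + 'm) + ('n + 'm))" where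
  "open_loop_map sys = cong3 (open_A1 sys) (open_A2 sys) (open_A3 sys)"

lemma stab_gains_iff:
  "(F, Fbar) \<in> stab_gains sys \<longleftrightarrow> op_spectrum sym_mats (closed_loop_map sys F Fbar) \<subseteq> ball 0 1"
  by (simp add: stab_gains_def closed_loop_map_def cong3_def[abs_def])

lemma closed_loop_map_eq:
  "closed_loop_map sys F Fbar X = transpose (gain_mat F Fbar) ** open_loop_map sys X ** gain_mat F Fbar"
  by (simp add: closed_loop_map_def open_loop_map_def cal_eq_open_gain[where Fbar = Fbar] cong3_mult)

lemma open_loop_map_block_diag:
  "\<exists>H1 H2. open_loop_map sys (block_diag P1 P2) = block_diag H1 H2"
  unfolding open_loop_map_def cong3_def open_A1_def open_A2_def open_A3_def
  by (simp add: block_simps) blast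

lemma weight_eq: "weight Q Qbar R Rbar = block_diag (block_diag (Q + Qbar) (R + Rbar)) (block_diag Q R)"
  by (simp add: weight_def block_simps)

lemma gain_mat_vec_append:
  "gain_mat F Fbar *v vec_append x y =
     vec_append (vec_append x ((F + Fbar) *v x)) (vec_append y (F *v y))"
  by (simp add: gain_mat_def block_diag_vec_append vec_append_matrix_vector)

definition open_loop_adj :: "('n::finite, 'm::finite) mf_system \<Rightarrow>
    real^(('n + 'm) + ('n + 'm))^(('n + 'm) + ('n + 'm)) \<Rightarrow> real^('n + 'n)^('n + 'n)" where
  "open_loop_adj sys =
     cong3 (transpose (open_A1 sys)) (transpose (open_A2 sys)) (transpose (open_A3 sys))"

lemma D_star_eq:
  "D_star sys F Fbar S = gain_mat F Fbar ** open_loop_adj sys S ** transpose (gain_mat F Fbar)"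
  using cong3_transpose_mult[of "gain_mat F Fbar" "open_A1 sys" "open_A2 sys" "open_A3 sys" S]
  by (simp add: D_star_def open_loop_adj_def cong3_def flip: aug_eq_gain_open)

lemma closed_loop_adj_eq:
  "closed_loop_adj sys F Fbar Y =
     open_loop_adj sys (gain_mat F Fbar ** Y ** transpose (gain_mat F Fbar))"
  by (simp add: closed_loop_adj_def open_loop_adj_def cong3_def cal_eq_open_gain[where Fbar = Fbar]
      matrix_transpose_mul matrix_mul_assoc)

lemma positive_map_loops [simp]:
  "positive_map (closed_loop_map sys F Fbar)" "positive_map (closed_loop_adj sys F Fbar)"
  "positive_map (open_loop_map sys)" "positive_map (open_loop_adj sys)"
  by (simp_all add: closed_loop_map_def closed_loop_adj_def open_loop_map_def open_loop_adj_def positive_map_cong3)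

lemma trace_adjoint_closed: "trace_adjoint (closed_loop_map sys F Fbar) (closed_loop_adj sys F Fbar)"
  and trace_adjoint_open: "trace_adjoint (open_loop_map sys) (open_loop_adj sys)"
  by (simp_all add: closed_loop_map_def closed_loop_adj_def open_loop_map_def open_loop_adj_def trace_adjoint_cong3)

section \<open>Value iteration\<close>

text \<open>
  The value of one step under a fixed feedback when \<open>X\<close> is the terminal cost. The matrix in parentheses
  is the cost of a state and control pair before the control is substituted.
\<close>

definition bellman ::
  "('n::finite, 'm::finite) mf_system \<Rightarrow> real^(('n + 'm) + ('n + 'm))^(('n + 'm) + ('n + 'm)) \<Rightarrow>
    real^'n^'m \<Rightarrow> real^'n^'m \<Rightarrow> real^('n + 'n)^('n + 'n) \<Rightarrow> real^('n + 'n)^('n + 'n)" where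
  "bellman sys W F Fbar X =
     transpose (gain_mat F Fbar) ** (W + open_loop_map sys X) ** gain_mat F Fbar"

lemma bellman_eq:
  "bellman sys W F Fbar X =
     closed_loop_map sys F Fbar X + transpose (gain_mat F Fbar) ** W ** gain_mat F Fbar"
  by (simp add: bellman_def closed_loop_map_eq matrix_mul_simps)

lemma bellman_diff: "bellman sys W F Fbar X - bellman sys W F Fbar Y = closed_loop_map sys F Fbar (X - Y)"
  by (simp add: bellman_eq positive_map_simps[OF positive_map_loops(1)])

lemma bellman_midpoint:
  "bellman sys W F Fbar ((1/2) *\<^sub>R (X + Y)) =
     (1/2) *\<^sub>R (bellman sys W F Fbar X + bellman sys W F Fbar Y)"
proof -
  have "(1/2) *\<^sub>R (C + C) = C" for C :: "real^'a^'b"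
    by (simp add: flip: scaleR_2)
  then show ?thesis
    by (simp add: bellman_eq positive_map_simps[OF positive_map_loops(1)] scaleR_add_right
        algebra_simps flip: scaleR_add_left)
qed

lemma psd_bellman: "psd W \<Longrightarrow> psd X \<Longrightarrow> psd (bellman sys W F Fbar X)"
  unfolding bellman_def by (intro psd_intros positive_map_psd[OF positive_map_loops(3)])

lemma posdef_add_psd: "posdef S \<Longrightarrow> psd T \<Longrightarrow> posdef (S + T)"
  by (auto simp: posdef_iff psd_iff intro: sym_mats_intros add_pos_nonneg)

lemma posdef_scaleR: "posdef S \<Longrightarrow> 0 < c \<Longrightarrow> posdef (c *\<^sub>R S)"
  by (auto simp: posdef_iff intro: sym_mats_intros)

text \<open>
  Gains act separately on the mean and the deviation, so a minimizing gain pair exists only if the cost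
  does not couple these two components; the property has to be carried along the iteration.
\<close>

definition block_diagonal :: "real^('a::finite + 'b::finite)^('a + 'b) \<Rightarrow> bool" where
  "block_diagonal X \<longleftrightarrow> (\<exists>A D. X = block_diag A D)"

lemma block_diagonal_intros:
  "block_diagonal X \<Longrightarrow> block_diagonal Y \<Longrightarrow> block_diagonal (X + Y)"
  "block_diagonal X \<Longrightarrow> block_diagonal (c *\<^sub>R X)"
  "block_diagonal (mat 1)"
  "block_diagonal 0"
  "block_diagonal X \<Longrightarrow> block_diagonal (open_loop_map sys X)"
  "block_diagonal Y' \<Longrightarrow> block_diagonal (transpose (gain_mat F Fbar) ** Y' ** gain_mat F Fbar)"
proof -
  show "block_diagonal (X + Y)" if "block_diagonal X" "block_diagonal Y"
    using that unfolding block_diagonal_def by (elim exE) (simp add: block_simps, blast)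
  show "block_diagonal (c *\<^sub>R X)" if "block_diagonal X"
    using that unfolding block_diagonal_def by (elim exE) (simp add: block_simps, blast)
  have "mat 1 = block_diag (mat 1) (mat 1)"
    by (simp add: block_diag_def vec_eq_iff all_sum_type mat_def)
  then show "block_diagonal (mat 1)" unfolding block_diagonal_def by blast
  have "0 = block_diag 0 0"
    by (simp add: block_diag_def vec_eq_iff all_sum_type)
  then show "block_diagonal 0" unfolding block_diagonal_def by blast
  show "block_diagonal (open_loop_map sys X)" if "block_diagonal X"
    using that open_loop_map_block_diag by (metis block_diagonal_def)
  show "block_diagonal (transpose (gain_mat F Fbar) ** Y' ** gain_mat F Fbar)"
    if "block_diagonal Y'"
    using that unfolding block_diagonal_def gain_mat_def
    by (elim exE) (simp add: block_simps, blast)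
qed

lemma psd_weight:
  assumes "psd Q" "psd (Q + Qbar)" "psd R" "psd (R + Rbar)"
  shows "psd (weight Q Qbar R Rbar)"
  unfolding weight_eq by (intro psd_block_diag assms)

text \<open>
  On block diagonal costs the minimization splits into the choice of \<open>F + Fbar\<close> for the mean and of \<open>F\<close>
  for the deviation. These two matrices can be prescribed independently.
\<close>

lemma greedy_gain:
  assumes Q: "psd Q" "psd (Q + Qbar)" and R: "posdef R" "posdef (R + Rbar)"
    and X: "psd X" "block_diagonal X"
  obtains F Fbar where
    "\<And>F' Fbar'. psd (bellman sys (weight Q Qbar R Rbar) F' Fbar' X - bellman sys (weight Q Qbar R Rbar) F Fbar X)"
proof -
  let ?W = "weight Q Qbar R Rbar"
  define H where "H = ?W + open_loop_map sys X"
  have psdH: "psd H"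
    unfolding H_def using R
    by (intro psd_intros psd_weight Q positive_map_psd[OF positive_map_loops(3)] X posdef_imp_psd)
  have "block_diagonal H"
    unfolding H_def
    by (intro block_diagonal_intros X) (auto simp: block_diagonal_def weight_eq)
  then obtain H1 H2 where H: "H = block_diag H1 H2" by (auto simp: block_diagonal_def)
  have sym: "H1 \<in> sym_mats" "H2 \<in> sym_mats"
    using psd_imp_sym[OF psdH] by (simp_all add: H block_diag_sym)
  have ge: "qform ?W v \<le> qform H v" for v
    using psdD[OF positive_map_psd[OF positive_map_loops(3) X(1)], of sys v] by (simp add: H_def)
  have zero: "qform M 0 = 0" for M :: "real^'c^'c" by (simp add: qform_def)
  have "0 < qform H1 (vec_append 0 u)" if "u \<noteq> 0" for u
  proof -
    have "0 < qform (R + Rbar) u" using R(2) that unfolding posdef_iff by blast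
    also have "\<dots> = qform ?W (vec_append (vec_append 0 u) 0)"
      by (simp only: weight_eq qform_block_diag zero add_0_left add_0_right)
    also have "\<dots> \<le> qform H1 (vec_append 0 u)"
      using ge[of "vec_append (vec_append 0 u) 0"] by (simp add: H qform_block_diag zero)
    finally show ?thesis .
  qed
  then obtain K where K: "\<And>x u. qform H1 (vec_append x (K *v x)) \<le> qform H1 (vec_append x u)"
    using quadratic_minimizer[OF sym(1)] by auto
  have "0 < qform H2 (vec_append 0 u)" if "u \<noteq> 0" for u
  proof -
    have "0 < qform R u" using R(1) that unfolding posdef_iff by blast
    also have "\<dots> = qform ?W (vec_append 0 (vec_append 0 u))"
      by (simp only: weight_eq qform_block_diag zero add_0_left add_0_right)
    also have "\<dots> \<le> qform H2 (vec_append 0 u)"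
      using ge[of "vec_append 0 (vec_append 0 u)"] by (simp add: H qform_block_diag zero)
    finally show ?thesis .
  qed
  then obtain F where F: "\<And>x u. qform H2 (vec_append x (F *v x)) \<le> qform H2 (vec_append x u)"
    using quadratic_minimizer[OF sym(2)] by auto
  have bell: "bellman sys ?W F' Fbar' X = transpose (gain_mat F' Fbar') ** H ** gain_mat F' Fbar'"
    for F' Fbar' by (simp add: bellman_def H_def)
  \<comment> \<open>The gain of the mean is the sum of the two feedback matrices, so the second one is \<open>K - F\<close>.\<close>
  have "psd (bellman sys ?W F' Fbar' X - bellman sys ?W F (K - F) X)" for F' Fbar'
  proof (rule psdI)
    show "bellman sys ?W F' Fbar' X - bellman sys ?W F (K - F) X \<in> sym_mats"
      unfolding bell by (intro sym_mats_intros psd_imp_sym[OF psdH])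
    fix v :: "real^('a + 'a)"
    obtain x y where v: "v = vec_append x y" by (rule vec_append_cases)
    have "F + (K - F) = K" by simp
    then show "0 \<le> qform (bellman sys ?W F' Fbar' X - bellman sys ?W F (K - F) X) v"
      using K[of x "(F' + Fbar') *v x"] F[of y "F' *v y"]
      by (simp add: bell qform_congruence v gain_mat_vec_append H qform_block_diag)
  qed
  then show ?thesis by (rule that)
qed

text \<open>
  Positive definiteness of the difference, rather than semidefiniteness, is what makes the gain pair
  stabilizing.
\<close>

definition supersolution ::
  "('n::finite, 'm::finite) mf_system \<Rightarrow> real^(('n + 'm) + ('n + 'm))^(('n + 'm) + ('n + 'm)) \<Rightarrow>
    real^'n^'m \<Rightarrow> real^'n^'m \<Rightarrow> real^('n + 'n)^('n + 'n) \<Rightarrow> bool" where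
  "supersolution sys W F Fbar X \<longleftrightarrow>
     psd X \<and> block_diagonal X \<and> posdef (X - bellman sys W F Fbar X)"

lemma supersolution_lyapunov:
  assumes "psd W" "supersolution sys W F Fbar X"
  shows "lyapunov (closed_loop_map sys F Fbar) X"
proof -
  have "posdef ((X - bellman sys W F Fbar X) + transpose (gain_mat F Fbar) ** W ** gain_mat F Fbar)"
    using assms by (intro posdef_add_psd psd_intros) (auto simp: supersolution_def)
  then show ?thesis using assms by (simp add: lyapunov_def supersolution_def bellman_eq)
qed

text \<open>
  The full step \<open>X \<mapsto> T X\<close> of the greedy gain may lose strictness, as \<open>T X - T (T X)\<close> need not be definite.
  Averaging with \<open>X\<close> keeps half of the definite difference \<open>X - T X\<close>. The last property compares with
  an arbitrary gain pair and survives the passage to the limit.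
\<close>

lemma value_iteration_step:
  assumes Q: "psd Q" "psd (Q + Qbar)" and R: "posdef R" "posdef (R + Rbar)"
    and W: "W = weight Q Qbar R Rbar" and X: "supersolution sys W F Fbar X"
  obtains X' F' Fbar' where "supersolution sys W F' Fbar' X'" "psd (X - X')"
    "\<And>F'' Fbar''. psd ((1/2) *\<^sub>R (X + bellman sys W F'' Fbar'' X) - X')"
proof -
  have X': "psd X" "block_diagonal X" "posdef (X - bellman sys W F Fbar X)"
    using X by (simp_all add: supersolution_def)
  obtain G Gbar where G: "\<And>F' Fbar'. psd (bellman sys W F' Fbar' X - bellman sys W G Gbar X)"
    using greedy_gain[OF Q R X'(1,2)] unfolding W by metis
  define T where "T = bellman sys W G Gbar"
  define Y where "Y = (1/2) *\<^sub>R (X + T X)"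
  have psdW: "psd W" unfolding W using R by (intro psd_weight Q posdef_imp_psd)
  have pd: "posdef (X - T X)"
    using posdef_add_psd[OF X'(3) G[of F Fbar]] by (simp add: T_def)
  have "posdef ((1/2) *\<^sub>R (X - T X) + (1/2) *\<^sub>R (T X - T (T X)))"
    unfolding T_def bellman_diff[of sys W G Gbar X] using pd
    by (intro posdef_add_psd posdef_scaleR psd_intros positive_map_psd[OF positive_map_loops(1)])
       (auto simp: T_def intro: posdef_imp_psd)
  also have "(1/2) *\<^sub>R (X - T X) + (1/2) *\<^sub>R (T X - T (T X)) = Y - T Y"
    by (simp only: Y_def T_def bellman_midpoint) (simp add: algebra_simps)
  finally have "posdef (Y - T Y)" .
  moreover have "psd Y"
    unfolding Y_def T_def using X'(1) psdW by (intro psd_intros psd_bellman) auto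
  moreover have "block_diagonal W"
    unfolding W weight_eq block_diagonal_def by blast
  then have "block_diagonal Y"
    unfolding Y_def T_def bellman_def using X'(2) by (intro block_diagonal_intros)
  ultimately have "supersolution sys W G Gbar Y"
    by (simp add: supersolution_def T_def)
  moreover have "psd ((1/2) *\<^sub>R (X - T X))"
    using posdef_imp_psd[OF pd] by (intro psd_intros) auto
  then have "psd (X - Y)"
    by (rule back_subst) (simp add: Y_def vec_eq_iff field_simps)
  moreover have "psd ((1/2) *\<^sub>R (X + bellman sys W F'' Fbar'' X) - Y)" for F'' Fbar''
  proof -
    have "psd ((1/2) *\<^sub>R (bellman sys W F'' Fbar'' X - T X))"
      using G unfolding T_def by (intro psd_intros) auto
    then show ?thesis by (simp add: Y_def algebra_simps)
  qed
  ultimately show ?thesis by (rule that)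
qed

text \<open>
  The iterates decrease and are bounded below by \<open>0\<close>. In the limit the comparison
  \<open>P \<le> (P + T\<^sub>g P) / 2\<close> becomes \<open>P \<le> T\<^sub>g P\<close>. The greedy gains need not converge, so the limit itself is not
  claimed to be a supersolution.
\<close>

lemma value_iteration_limit:
  assumes Q: "psd Q" "psd (Q + Qbar)" and R: "posdef R" "posdef (R + Rbar)"
    and W: "W = weight Q Qbar R Rbar" and start: "supersolution sys W F0 Fbar0 X0"
  obtains X P where "P \<in> sym_mats" "X \<longlonglongrightarrow> P"
    "\<And>k. \<exists>F Fbar. supersolution sys W F Fbar (X k)"
    "\<And>F Fbar. psd (bellman sys W F Fbar P - P)"
proof -
  let ?super = "\<lambda>X. \<exists>F Fbar. supersolution sys W F Fbar X"
  let ?step = "\<lambda>X X'. psd (X - X') \<and>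
    (\<forall>F Fbar. psd ((1/2) *\<^sub>R (X + bellman sys W F Fbar X) - X'))"
  have step: "\<exists>X'. ?super X' \<and> ?step X X'" if super: "?super X" for X
  proof -
    obtain F Fbar where "supersolution sys W F Fbar X" using super by (elim exE)
    then obtain X' F' Fbar' where "supersolution sys W F' Fbar' X'" "psd (X - X')"
      "\<And>F'' Fbar''. psd ((1/2) *\<^sub>R (X + bellman sys W F'' Fbar'' X) - X')"
      by (rule value_iteration_step[OF Q R W]) (rule that)
    then show ?thesis by (intro exI[of _ X']) blast
  qed
  have "\<exists>X. ?super X" using start by blast
  from dependent_nat_choice[of "\<lambda>_. ?super" "\<lambda>_. ?step", OF this step]
  obtain X where X: "\<And>k. ?super (X k)" "\<And>k. ?step (X k) (X (Suc k))" by blast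
  have psdX: "psd (X k)" for k using X(1) by (auto simp: supersolution_def)
  have bound: "qform (- X k) x \<le> 0" for k x using psdD[OF psdX] by simp
  have mono: "psd (- X (Suc k) - - X k)" for k using X(2) by simp
  have sym: "- X k \<in> sym_mats" for k using psdX by (intro sym_mats_intros psd_imp_sym)
  obtain S where S: "S \<in> sym_mats" "(\<lambda>k. - X k) \<longlonglongrightarrow> S"
    by (rule psd_incseq_convergent[of "\<lambda>k. - X k", OF sym mono bound])
  define P where "P = - S"
  have lim: "X \<longlonglongrightarrow> P"
    using tendsto_minus[OF S(2)] by (simp add: P_def)
  have "psd (bellman sys W F Fbar P - P)" for F Fbar
  proof -
    have "(\<lambda>k. bellman sys W F Fbar (X k)) \<longlonglongrightarrow> bellman sys W F Fbar P"
      unfolding bellman_eq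
      by (intro tendsto_add tendsto_const tendsto_positive_map[OF positive_map_loops(1)] lim)
    then have "(\<lambda>k. 2 *\<^sub>R ((1/2) *\<^sub>R (X k + bellman sys W F Fbar (X k)) - X (Suc k)))
        \<longlonglongrightarrow> 2 *\<^sub>R ((1/2) *\<^sub>R (P + bellman sys W F Fbar P) - P)"
      by (intro tendsto_scaleR tendsto_diff tendsto_add tendsto_const lim LIMSEQ_Suc)
    then have "psd (2 *\<^sub>R ((1/2) *\<^sub>R (P + bellman sys W F Fbar P) - P))"
      by (rule tendsto_psd[rotated]) (use X(2) in \<open>auto intro: psd_intros(4)\<close>)
    also have "2 *\<^sub>R ((1/2) *\<^sub>R (P + bellman sys W F Fbar P) - P) = bellman sys W F Fbar P - P"
      by (simp add: scaleR_diff_right scaleR_2)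
    finally show ?thesis .
  qed
  moreover have "P \<in> sym_mats" using S(1) by (auto simp: P_def intro: sym_mats_intros)
  ultimately show ?thesis using that X(1) lim by blast
qed

section \<open>Primal and dual bounds\<close>

lemma trace_cycle: "trace (G ** A ** transpose G ** H) = trace (A ** (transpose G ** H ** (G :: real^'p^'q)))"
  using trace_mul_sym[of G "A ** transpose G ** H"] by (simp add: matrix_mul_assoc)

text \<open>
  A supersolution makes its gain pair stabilizing, the solution \<open>Y\<close> of the adjoint equation yields the
  feasible point \<open>G Y G\<^sup>T\<close>, and the supersolution property bounds the cost of that point.
\<close>

lemma primal_value_le:
  assumes W: "W = weight Q Qbar R Rbar" "psd W" and Z: "psd (block_diag Z2 (Z1 - Z2))"
    and X: "supersolution sys W F Fbar X"
  shows "primal_value sys Q Qbar R Rbar Z1 Z2 \<le> ereal (trace (X ** block_diag Z2 (Z1 - Z2)))"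
proof -
  let ?G = "gain_mat F Fbar"
  let ?Z = "block_diag Z2 (Z1 - Z2)"
  have lyap: "lyapunov (closed_loop_map sys F Fbar) X"
    by (rule supersolution_lyapunov[OF W(2) X])
  obtain Y where Y: "psd Y" "Y = closed_loop_adj sys F Fbar Y + ?Z"
    by (rule adjoint_lyapunov_equation_solvable[OF positive_map_loops(1) lyap positive_map_loops(2)
          trace_adjoint_closed Z])
  define S where "S = ?G ** Y ** transpose ?G"
  have "psd (transpose (transpose ?G) ** Y ** transpose ?G)"
    by (intro psd_intros Y)
  then have "S \<in> sym_mats" by (simp add: S_def psd_imp_sym)
  moreover have "(F, Fbar) \<in> stab_gains sys"
    unfolding stab_gains_iff by (rule lyapunov_imp_spectrum_in_disc[OF positive_map_loops(1) lyap])
  moreover have "D_star sys F Fbar S + init_term F Fbar Z1 Z2 = S"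
  proof -
    have "D_star sys F Fbar S + init_term F Fbar Z1 Z2 =
        ?G ** (closed_loop_adj sys F Fbar Y + ?Z) ** transpose ?G"
      by (simp add: D_star_eq init_term_eq_gain S_def closed_loop_adj_eq matrix_mul_simps)
    then show ?thesis using Y(2) by (simp add: S_def)
  qed
  ultimately have "primal_value sys Q Qbar R Rbar Z1 Z2 \<le> ereal (trace (W ** S))"
    unfolding primal_value_def W(1) by (intro Inf_lower) blast
  also have "trace (W ** S) = trace ((transpose ?G ** W ** ?G) ** Y)"
    using trace_cycle[of ?G Y W] trace_mul_sym[of W S] trace_mul_sym[of Y]
    by (simp add: S_def)
  also have "\<dots> \<le> trace (X ** ?Z)"
  proof (rule adjoint_lyapunov_equation_cost[OF trace_adjoint_closed Y])
    show "psd (X - (closed_loop_map sys F Fbar X + transpose ?G ** W ** ?G))"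
      unfolding bellman_eq[symmetric] using X
      by (intro posdef_imp_psd) (simp add: supersolution_def)
  qed
  finally show ?thesis by simp
qed

text \<open>
  The multiplier is the state and control cost \<open>H = W + L P\<close>. For \<open>S \<ge> 0\<close> the Lagrangian is the sum of two
  pairings in which \<open>P \<le> T\<^sub>g P\<close> can be used: against the one-step image of \<open>S\<close>, where all terms in \<open>S\<close>
  then cancel, and against the initial data, which leaves \<open>trace (P Z)\<close>.
\<close>

lemma dual_value_ge:
  assumes W: "W = weight Q Qbar R Rbar" "psd W" and Z: "psd (block_diag Z2 (Z1 - Z2))"
    and P: "P \<in> sym_mats" "\<And>F Fbar. psd (bellman sys W F Fbar P - P)"
  shows "ereal (trace (P ** block_diag Z2 (Z1 - Z2))) \<le> dual_value sys Q Qbar R Rbar Z1 Z2"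
proof -
  let ?Z = "block_diag Z2 (Z1 - Z2)"
  define X where "X = W + open_loop_map sys P"
  have symX: "X \<in> sym_mats"
    unfolding X_def by (intro sym_mats_intros psd_imp_sym[OF W(2)] positive_map_sym[OF positive_map_loops(3)] P)
  have "trace (P ** ?Z) \<le> lagrangian sys Q Qbar R Rbar Z1 Z2 X F Fbar S" if S: "psd S" for F Fbar S
  proof -
    let ?G = "gain_mat F Fbar"
    have "trace (D_star sys F Fbar S ** X) = trace (open_loop_adj sys S ** bellman sys W F Fbar P)"
      by (simp add: D_star_eq bellman_def X_def trace_cycle)
    moreover have "trace (open_loop_adj sys S ** P) \<le> trace (open_loop_adj sys S ** bellman sys W F Fbar P)"
      by (intro trace_mult_mono positive_map_psd[OF positive_map_loops(4)] S P)
    moreover have "trace (open_loop_adj sys S ** P) = trace (S ** X) - trace (W ** S)"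
      using trace_adjointD[OF trace_adjoint_open, of sys P S]
        trace_mul_sym[of "open_loop_adj sys S" P] trace_mul_sym[of S W] trace_mul_sym[of S "open_loop_map sys P"]
      by (simp add: X_def matrix_mul_simps trace_add)
    moreover have "trace (init_term F Fbar Z1 Z2 ** X) = trace (?Z ** bellman sys W F Fbar P)"
      by (simp add: init_term_eq_gain bellman_def X_def trace_cycle)
    moreover have "trace (?Z ** P) \<le> trace (?Z ** bellman sys W F Fbar P)"
      by (intro trace_mult_mono Z P)
    ultimately show ?thesis
      using trace_mul_sym[of P ?Z]
      by (simp add: lagrangian_def matrix_mul_simps trace_add trace_sub flip: W(1))
  qed
  then have "ereal (trace (P ** ?Z)) \<le> Inf {ereal (lagrangian sys Q Qbar R Rbar Z1 Z2 X F Fbar S) | S F Fbar.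
               psd S \<and> (F, Fbar) \<in> stab_gains sys}"
    by (intro Inf_greatest) auto
  then show ?thesis
    unfolding dual_value_def by (rule SUP_upper2[OF symX])
qed

text \<open>
  The constraint makes \<open>S\<close> a congruence of a matrix \<open>Y\<close> that solves the adjoint Lyapunov equation of a
  stable map.
\<close>

lemma feasible_imp_psd:
  assumes Z: "psd (block_diag Z2 (Z1 - Z2))" and F: "(F, Fbar) \<in> stab_gains sys"
    and S: "S \<in> sym_mats" "D_star sys F Fbar S + init_term F Fbar Z1 Z2 = S"
  shows "psd S"
proof -
  let ?G = "gain_mat F Fbar"
  define Y where "Y = open_loop_adj sys S + block_diag Z2 (Z1 - Z2)"
  have SY: "S = ?G ** Y ** transpose ?G"
    using S(2) by (simp add: Y_def D_star_eq init_term_eq_gain matrix_mul_simps)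
  obtain X where X: "lyapunov (closed_loop_map sys F Fbar) X"
    using spectrum_in_disc_imp_lyapunov[OF positive_map_loops(1)] F unfolding stab_gains_iff by blast
  have "psd Y"
  proof (rule adjoint_lyapunov_equation_psd[OF positive_map_loops(1) X trace_adjoint_closed Z])
    show "Y \<in> sym_mats"
      unfolding Y_def by (intro sym_mats_intros positive_map_sym[OF positive_map_loops(4)] S(1) psd_imp_sym[OF Z])
    show "Y = closed_loop_adj sys F Fbar Y + block_diag Z2 (Z1 - Z2)"
      unfolding closed_loop_adj_eq SY[symmetric] by (simp add: Y_def)
  qed
  then have "psd (transpose (transpose ?G) ** Y ** transpose ?G)" by (intro psd_intros)
  then show ?thesis by (simp add: SY)
qed

lemma weak_duality:
  assumes Z: "psd (block_diag Z2 (Z1 - Z2))"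
  shows "dual_value sys Q Qbar R Rbar Z1 Z2 \<le> primal_value sys Q Qbar R Rbar Z1 Z2"
  unfolding dual_value_def primal_value_def
proof (intro SUP_least Inf_greatest)
  fix X v
  assume "X \<in> (sym_mats :: (real^(('a + 'b) + ('a + 'b))^(('a + 'b) + ('a + 'b))) set)"
    and "v \<in> {ereal (trace (weight Q Qbar R Rbar ** S)) | S F Fbar.
            S \<in> sym_mats \<and> (F, Fbar) \<in> stab_gains sys \<and>
            D_star sys F Fbar S + init_term F Fbar Z1 Z2 = S}"
  then obtain S F Fbar where S: "S \<in> sym_mats" "(F, Fbar) \<in> stab_gains sys"
    "D_star sys F Fbar S + init_term F Fbar Z1 Z2 = S"
    and v: "v = ereal (trace (weight Q Qbar R Rbar ** S))" by blast
  have "D_star sys F Fbar S - S + init_term F Fbar Z1 Z2 = 0"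
    using S(3) by (simp add: algebra_simps)
  then have "v = ereal (lagrangian sys Q Qbar R Rbar Z1 Z2 X F Fbar S)"
    by (simp add: v lagrangian_def)
  then show "Inf {ereal (lagrangian sys Q Qbar R Rbar Z1 Z2 X F Fbar S) | S F Fbar.
               psd S \<and> (F, Fbar) \<in> stab_gains sys} \<le> v"
    using S(2) feasible_imp_psd[OF Z S(2,1,3)] by (intro Inf_lower) blast
qed

lemma strong_duality_of_supersolution:
  assumes Q: "psd Q" "psd (Q + Qbar)" and R: "posdef R" "posdef (R + Rbar)"
    and Z: "psd (block_diag Z2 (Z1 - Z2))"
    and X0: "supersolution sys (weight Q Qbar R Rbar) F0 Fbar0 X0"
  shows "dual_value sys Q Qbar R Rbar Z1 Z2 = primal_value sys Q Qbar R Rbar Z1 Z2"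
proof (rule antisym[OF weak_duality[OF Z]])
  let ?Z = "block_diag Z2 (Z1 - Z2)"
  define W where "W = weight Q Qbar R Rbar"
  have psdW: "psd W" unfolding W_def using R by (intro psd_weight Q posdef_imp_psd)
  obtain X P where P: "P \<in> sym_mats" "X \<longlonglongrightarrow> P"
    "\<And>k. \<exists>F Fbar. supersolution sys W F Fbar (X k)"
    "\<And>F Fbar. psd (bellman sys W F Fbar P - P)"
    by (rule value_iteration_limit[OF Q R W_def X0[folded W_def]]) (rule that)
  have "linear (\<lambda>X. trace (X ** ?Z))"
    by (rule linearI) (simp_all add: matrix_mul_simps matrix_scaleR_simps trace_add trace_scaleR)
  then have "bounded_linear (\<lambda>X. trace (X ** ?Z))"
    by (simp add: linear_conv_bounded_linear)
  from bounded_linear.tendsto[OF this P(2)]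
  have lim: "(\<lambda>k. ereal (trace (X k ** ?Z))) \<longlonglongrightarrow> ereal (trace (P ** ?Z))"
    by simp
  have "primal_value sys Q Qbar R Rbar Z1 Z2 \<le> ereal (trace (X k ** ?Z))" for k
    using P(3)[of k] primal_value_le[OF W_def psdW Z] by blast
  then have "primal_value sys Q Qbar R Rbar Z1 Z2 \<le> ereal (trace (P ** ?Z))"
    by (intro LIMSEQ_le_const[OF lim]) blast
  also have "\<dots> \<le> dual_value sys Q Qbar R Rbar Z1 Z2"
    by (rule dual_value_ge[OF W_def psdW Z P(1,4)])
  finally show "primal_value sys Q Qbar R Rbar Z1 Z2 \<le> dual_value sys Q Qbar R Rbar Z1 Z2" .
qed

section \<open>A supersolution from decaying second moments\<close>

text \<open>
  With \<open>S\<close> the sum of the first \<open>k\<close> powers applied to \<open>I\<close>, \<open>S - L S = I - L\<^sup>k I\<close>, which is at least \<open>I / 2\<close>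
  once the trace of \<open>L\<^sup>k I\<close> is below \<open>1 / 2\<close>. A large multiple of \<open>S\<close> then also absorbs the running cost.
\<close>

lemma supersolution_of_decay:
  assumes W: "psd W" and Z: "posdef Z"
    and decay: "(\<lambda>k. trace (Z ** (closed_loop_map sys F Fbar ^^ k) (mat 1))) \<longlonglongrightarrow> 0"
  obtains X where "supersolution sys W F Fbar X"
proof -
  let ?L = "closed_loop_map sys F Fbar"
  note L = positive_map_loops(1)[of sys F Fbar]
  obtain e where e: "0 < e" "psd (Z - e *\<^sub>R mat 1)"
    by (rule posdef_ge_scaled_id[OF Z])
  have psd_pow: "psd ((?L ^^ k) (mat 1))" for k
    by (induction k) (auto intro: positive_map_psd[OF L])
  obtain k where k: "trace (Z ** (?L ^^ k) (mat 1)) < e / 2"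
    using order_tendstoD(2)[OF decay, of "e / 2"] e(1) by (auto simp: eventually_sequentially)
  have "e * trace ((?L ^^ k) (mat 1)) \<le> trace (Z ** (?L ^^ k) (mat 1))"
    using trace_mult_nonneg[OF e(2) psd_pow[of k]]
    by (simp add: matrix_mul_simps matrix_scaleR_simps trace_sub trace_scaleR)
  then have "e * trace ((?L ^^ k) (mat 1)) < e * (1 / 2)" using k by simp
  then have tr: "trace ((?L ^^ k) (mat 1)) < 1 / 2" using e(1) by (simp only: mult_less_cancel_left_pos)
  define S where "S = (\<Sum>j<k. (?L ^^ j) (mat 1))"
  have "?L S = (\<Sum>j<k. (?L ^^ Suc j) (mat 1))"
    using L by (simp add: S_def positive_map_def linear_sum)
  then have tele: "S - ?L S = mat 1 - (?L ^^ k) (mat 1)"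
    using sum_lessThan_telescope[of "\<lambda>j. (?L ^^ j) (mat 1)" k]
    by (simp add: S_def sum_subtractf) (metis minus_diff_eq)
  have bd: "block_diagonal ((?L ^^ j) (mat 1))" for j
    by (induction j) (auto simp: closed_loop_map_eq intro: block_diagonal_intros)
  have S: "psd S" "block_diagonal S"
    unfolding S_def by (induction k) (auto intro: psd_intros block_diagonal_intros psd_pow bd)
  define C where "C = transpose (gain_mat F Fbar) ** W ** gain_mat F Fbar"
  have psdC: "psd C" unfolding C_def by (intro psd_intros W)
  obtain t where t: "0 < t" "psd (t *\<^sub>R mat 1 - C)" "psd (t *\<^sub>R mat 1 + C)"
    by (rule sym_mats_le_scaled_id[OF psd_imp_sym[OF psdC]])
  \<comment> \<open>The factor makes \<open>X - L X\<close> at least \<open>2 t I\<close>; one \<open>t I\<close> dominates \<open>C\<close> and the other is left over.\<close>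
  define X where "X = (4 * t) *\<^sub>R S"
  have half: "psd (S - ?L S - (1/2) *\<^sub>R mat 1)"
  proof (rule psdI)
    show "S - ?L S - (1/2) *\<^sub>R mat 1 \<in> sym_mats"
      by (intro sym_mats_intros psd_imp_sym[OF S(1)] positive_map_sym[OF L])
    fix x
    have "qform ((?L ^^ k) (mat 1)) x \<le> trace ((?L ^^ k) (mat 1)) * (x \<bullet> x)"
      by (rule psd_le_trace[OF psd_pow])
    also have "\<dots> \<le> 1 / 2 * (x \<bullet> x)" using tr by (intro mult_right_mono) auto
    finally show "0 \<le> qform (S - ?L S - (1/2) *\<^sub>R mat 1) x" by (simp add: tele)
  qed
  have "psd ((4 * t) *\<^sub>R (S - ?L S - (1/2) *\<^sub>R mat 1) + (t *\<^sub>R mat 1 - C))"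
    using t(1) by (intro psd_intros half t(2)) auto
  also have "(4 * t) *\<^sub>R (S - ?L S - (1/2) *\<^sub>R mat 1) + (t *\<^sub>R mat 1 - C)
      = X - bellman sys W F Fbar X - t *\<^sub>R mat 1"
    by (simp add: X_def bellman_eq C_def positive_map_simps[OF L] vec_eq_iff field_simps)
  finally have "posdef (X - bellman sys W F Fbar X)"
    by (rule psd_ge_scaled_id_imp_posdef[OF t(1)])
  then have "supersolution sys W F Fbar X"
    using S t(1) by (auto simp: supersolution_def X_def intro: psd_intros block_diagonal_intros)
  then show ?thesis by (rule that)
qed

section \<open>Independence of the state from the current noise\<close>

lemma Int_stable_preimages: "Int_stable {g -` A \<inter> \<Omega> | A. A \<in> sets L}"
proof (rule Int_stableI, clarify)
  fix A B assume "A \<in> sets L" "B \<in> sets L"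
  then show "\<exists>C. g -` A \<inter> \<Omega> \<inter> (g -` B \<inter> \<Omega>) = g -` C \<inter> \<Omega> \<and> C \<in> sets L"
    by (intro exI[of _ "A \<inter> B"]) auto
qed

context prob_space
begin

text \<open>
  Index \<open>0\<close> carries the initial state and index \<open>k + 1\<close> the noise at time \<open>k\<close>, which turns the
  hypotheses on both into the independence of one family.
\<close>

definition past_gen :: "('a \<Rightarrow> real^'n) \<Rightarrow> (nat \<Rightarrow> 'a \<Rightarrow> real) \<Rightarrow> nat \<Rightarrow> 'a set set" where
  "past_gen z w i = (case i of
     0 \<Rightarrow> {z -` A \<inter> space M | A. A \<in> sets borel}
   | Suc k \<Rightarrow> {w k -` A \<inter> space M | A. A \<in> sets borel})"

text \<open>
  The information available at time \<open>k\<close>: the initial state and the noise before time \<open>k\<close>.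
\<close>

definition past :: "('a \<Rightarrow> real^'n) \<Rightarrow> (nat \<Rightarrow> 'a \<Rightarrow> real) \<Rightarrow> nat \<Rightarrow> 'a measure" where
  "past z w k = sigma (space M) (\<Union>i\<le>k. past_gen z w i)"

text \<open>
  If the initial state occurs in a finite intersection, its independence from the whole noise sequence
  splits off that factor; the remaining noise events factor by mutual independence.
\<close>

lemma indep_sets_past_gen:
  assumes w: "indep_vars (\<lambda>_. borel) w UNIV" and z: "initial_state M w z"
  shows "indep_sets (past_gen z w) UNIV"
proof (rule indep_setsI)
  have w_meas: "w k \<in> borel_measurable M" for k
    using w by (simp add: indep_vars_def2)
  have z_meas: "z \<in> borel_measurable M"
    using z by (simp add: initial_state_def)
  show "past_gen z w i \<subseteq> events" for i
    using w_meas z_meas by (auto simp: past_gen_def measurable_sets split: nat.splits)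
  fix A J
  assume J: "J \<noteq> {}" "finite (J :: nat set)" and A: "\<forall>j\<in>J. A j \<in> past_gen z w j"
  let ?V = "vimage_algebra (space M) (\<lambda>\<omega> k. w k \<omega>) (Pi\<^sub>M UNIV (\<lambda>_. borel))"
  define K where "K = {k. Suc k \<in> J}"
  have K: "finite K" unfolding K_def using J(2) by (auto intro: finite_vimageI simp flip: vimage_def)
  have AK: "A (Suc k) \<in> {w k -` B \<inter> space M | B. B \<in> sets borel}" if "k \<in> K" for k
    using A that by (auto simp: K_def past_gen_def)
  have probK: "prob (\<Inter>k\<in>K. A (Suc k)) = (\<Prod>k\<in>K. prob (A (Suc k)))" if "K \<noteq> {}"
    using w K that AK unfolding indep_vars_def2
    by (intro indep_setsD[of "\<lambda>i. {w i -` A \<inter> space M | A. A \<in> sets borel}" UNIV]) auto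
  have "x \<in> J - {0} \<longleftrightarrow> x \<in> Suc ` K" for x
    by (cases x) (auto simp: K_def)
  then have JK: "J - {0} = Suc ` K" by blast
  show "prob (\<Inter>j\<in>J. A j) = (\<Prod>j\<in>J. prob (A j))"
  proof (cases "0 \<in> J")
    case False
    then have J_eq: "J = Suc ` K" using JK by simp
    then have "K \<noteq> {}" using J(1) by auto
    then show ?thesis using probK by (simp add: J_eq prod.reindex)
  next
    case True
    then have J_eq: "J = insert 0 (Suc ` K)" using JK by blast
    show ?thesis
    proof (cases "K = {}")
      case True
      then show ?thesis by (simp add: J_eq)
    next
      case False
      have "A (Suc k) \<in> sets ?V" if k: "k \<in> K" for k
      proof -
        obtain B where B: "B \<in> sets borel" "A (Suc k) = w k -` B \<inter> space M"
          using AK[OF k] by blast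
        have "(\<lambda>f. f k) -` B \<inter> space (Pi\<^sub>M UNIV (\<lambda>_. borel)) \<in> sets (Pi\<^sub>M UNIV (\<lambda>_. borel :: real measure))"
          using B(1) by (intro measurable_sets[where A = borel]) auto
        then have "(\<lambda>\<omega> k. w k \<omega>) -` ((\<lambda>f. f k) -` B \<inter> space (Pi\<^sub>M UNIV (\<lambda>_. borel))) \<inter> space M \<in> sets ?V"
          by (rule in_vimage_algebra)
        also have "(\<lambda>\<omega> k. w k \<omega>) -` ((\<lambda>f. f k) -` B \<inter> space (Pi\<^sub>M UNIV (\<lambda>_. borel))) \<inter> space M = A (Suc k)"
          unfolding B(2) by (auto simp: space_PiM)
        finally show ?thesis .
      qed
      then have inV: "(\<Inter>k\<in>K. A (Suc k)) \<in> sets ?V"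
        using K False by (intro sets.finite_INT) auto
      have inZ: "A 0 \<in> sets (vimage_algebra (space M) z borel)"
        using bspec[OF A \<open>0 \<in> J\<close>] by (auto simp: past_gen_def intro: in_vimage_algebra)
      have "prob (A 0 \<inter> (\<Inter>k\<in>K. A (Suc k))) = prob (A 0) * prob (\<Inter>k\<in>K. A (Suc k))"
        using z inZ inV unfolding initial_state_def by (intro indep_setD) auto
      then show ?thesis
        using probK[OF False] K by (simp add: J_eq prod.reindex)
    qed
  qed
qed

lemma past_gen_subset: "past_gen z w i \<subseteq> Pow (space M)"
  by (auto simp: past_gen_def split: nat.splits)

lemma sets_past: "sets (past z w k) = sigma_sets (space M) (\<Union>i\<le>k. past_gen z w i)"
  and space_past [simp]: "space (past z w k) = space M"
proof -
  have "(\<Union>i\<le>k. past_gen z w i) \<subseteq> Pow (space M)"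
    using past_gen_subset by blast
  then show "sets (past z w k) = sigma_sets (space M) (\<Union>i\<le>k. past_gen z w i)"
    and "space (past z w k) = space M"
    by (simp_all add: past_def sets_measure_of space_measure_of)
qed

lemma sets_past_mono: "sets (past z w k) \<subseteq> sets (past z w (Suc k))"
  unfolding sets_past by (intro sigma_sets_mono' UN_mono) auto

lemma measurable_past_mono:
  "f \<in> measurable (past z w k) N \<Longrightarrow> f \<in> measurable (past z w (Suc k)) N"
  by (rule measurable_from_subalg[of "past z w (Suc k)" "past z w k"])
     (simp_all add: subalgebra_def sets_past_mono)

lemma measurable_past_gen:
  "z \<in> borel_measurable (past z w 0)" "w k \<in> borel_measurable (past z w (Suc k))"
proof -
  show "z \<in> borel_measurable (past z w 0)"
  proof (rule measurableI)
    fix A :: "(real^'b) set" assume "A \<in> sets borel"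
    then have "z -` A \<inter> space M \<in> past_gen z w 0" by (auto simp: past_gen_def)
    then show "z -` A \<inter> space (past z w 0) \<in> sets (past z w 0)"
      by (auto simp: sets_past)
  qed simp
  show "w k \<in> borel_measurable (past z w (Suc k))"
  proof (rule measurableI)
    fix A :: "real set" assume "A \<in> sets borel"
    then have "w k -` A \<inter> space M \<in> past_gen z w (Suc k)" by (auto simp: past_gen_def)
    then show "w k -` A \<inter> space (past z w (Suc k)) \<in> sets (past z w (Suc k))"
      by (auto simp: sets_past)
  qed simp
qed

lemma measurable_past_imp_measurable:
  assumes w: "indep_vars (\<lambda>_. borel) w UNIV" and z: "initial_state M w z"
    and f: "f \<in> measurable (past z w k) N"
  shows "f \<in> measurable M N"
proof (rule measurable_from_subalg[OF _ f])
  have "(\<Union>i\<le>k. past_gen z w i) \<subseteq> events"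
    using indep_sets_past_gen[OF w z] by (auto simp: indep_sets_def)
  then show "subalgebra M (past z w k)"
    unfolding subalgebra_def sets_past by (simp add: sets.sigma_sets_subset)
qed

text \<open>
  The event generators up to index \<open>k\<close> and the one at index \<open>k + 1\<close> are disjoint groups of an
  independent family, so the generated sigma-algebras are independent.
\<close>

lemma indep_past_noise:
  assumes w: "indep_vars (\<lambda>_. borel) w UNIV" and z: "initial_state M w z"
    and f: "f \<in> measurable (past z w k) (N :: real measure)"
  shows "indep_var N f borel (w k)"
proof -
  let ?I = "\<lambda>b. if b then {..k} else {Suc k}"
  have "indep_sets (\<lambda>b. sigma_sets (space M) (\<Union>i\<in>?I b. past_gen z w i)) UNIV"
  proof (rule indep_sets_collect_sigma)
    show "indep_sets (past_gen z w) (\<Union>b\<in>UNIV. ?I b)"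
      by (rule indep_sets_mono_index[OF _ indep_sets_past_gen[OF w z]]) simp
    show "disjoint_family_on ?I UNIV" by (auto simp: disjoint_family_on_def)
    show "Int_stable (past_gen z w i)" for i
      by (cases i) (simp_all add: past_gen_def Int_stable_preimages)
  qed
  then have indep: "indep_set (sets (past z w k)) (sigma_sets (space M) (past_gen z w (Suc k)))"
    unfolding indep_set_def sets_past
    by (rule indep_sets_mono_sets) (auto split: bool.splits)
  have "f \<in> measurable M N"
    by (rule measurable_past_imp_measurable[OF w z f])
  moreover have "{f -` A \<inter> space M | A. A \<in> sets N} \<subseteq> sets (past z w k)"
    using measurable_sets[OF f] by auto
  then have "sigma_sets (space M) {f -` A \<inter> space M | A. A \<in> sets N} \<subseteq> sets (past z w k)"
    using sets.sigma_sets_subset[of _ "past z w k"] by simp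
  moreover have "w k \<in> borel_measurable M" using w by (simp add: indep_vars_def2)
  ultimately show ?thesis
    using indep unfolding indep_var_eq
    by (auto simp: indep_sets2_eq past_gen_def)
qed

end

lemma measurable_mult_vec [measurable]:
  "f \<in> borel_measurable N \<Longrightarrow> (\<lambda>\<omega>. (A :: real^'p^'q) *v f \<omega>) \<in> borel_measurable N"
  by (rule measurable_compose[OF _ borel_measurable_continuous_onI[OF
          linear_continuous_on[OF matrix_vector_mul_bounded_linear]]])

lemma closed_loop_past_measurable:
  assumes "prob_space M"
  shows "closed_loop M w sys F Fbar z k \<in> borel_measurable (prob_space.past M z w k)"
proof (induction k)
  case 0
  then show ?case using prob_space.measurable_past_gen(1)[OF assms] by simp
next
  case (Suc k)
  have [measurable]: "closed_loop M w sys F Fbar z k \<in> borel_measurable (prob_space.past M z w (Suc k))"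
    "w k \<in> borel_measurable (prob_space.past M z w (Suc k))"
    using Suc prob_space.measurable_past_mono[OF assms] prob_space.measurable_past_gen(2)[OF assms]
    by blast+
  show ?case by (simp add: mf_step_def Let_def)
qed

lemma borel_measurable_closed_loop:
  assumes M: "prob_space M" and w: "noise M w" and z: "initial_state M w z"
  shows "closed_loop M w sys F Fbar z k \<in> borel_measurable M"
  using w by (intro prob_space.measurable_past_imp_measurable[OF M _ z closed_loop_past_measurable[OF M]])
    (simp add: noise_def)

lemma borel_measurable_qform [measurable]:
  "f \<in> borel_measurable N \<Longrightarrow> (\<lambda>\<omega>. qform S (f \<omega>)) \<in> borel_measurable N"
  unfolding qform_def by (intro borel_measurable_inner measurable_mult_vec)

lemma integrable_qform:
  assumes "f \<in> borel_measurable M" "integrable M (\<lambda>\<omega>. (norm (f \<omega>))\<^sup>2)"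
  shows "integrable M (\<lambda>\<omega>. qform S (f \<omega>))"
proof (rule Bochner_Integration.integrable_bound)
  show "integrable M (\<lambda>\<omega>. onorm ((*v) S) * (norm (f \<omega>))\<^sup>2)"
    using assms(2) by simp
  have "norm (qform S (f \<omega>)) \<le> norm (onorm ((*v) S) * (norm (f \<omega>))\<^sup>2)" for \<omega>
    unfolding real_norm_def by (rule order_trans[OF qform_le_norm abs_ge_self])
  then show "AE \<omega> in M. norm (qform S (f \<omega>)) \<le> norm (onorm ((*v) S) * (norm (f \<omega>))\<^sup>2)"
    by (intro AE_I2)
qed (use assms(1) in measurable)

lemma (in prob_space) integrable_of_square:
  fixes f :: "'a \<Rightarrow> real^'p"
  assumes "f \<in> borel_measurable M" "integrable M (\<lambda>\<omega>. (norm (f \<omega>))\<^sup>2)"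
  shows "integrable M f"
proof (rule Bochner_Integration.integrable_bound)
  show "integrable M (\<lambda>\<omega>. 1 + (norm (f \<omega>))\<^sup>2)" using assms(2) by simp
  have le: "norm x \<le> 1 + (norm x)\<^sup>2" for x :: "real^'p"
  proof -
    have "2 * norm x \<le> (norm x)\<^sup>2 + 1"
      using zero_le_power2[of "norm x - 1"] by (simp add: power2_diff)
    then show ?thesis using norm_ge_zero[of x] by linarith
  qed
  have "norm (f \<omega>) \<le> norm (1 + (norm (f \<omega>))\<^sup>2)" for \<omega>
    using le[of "f \<omega>"] by simp
  then show "AE \<omega> in M. norm (f \<omega>) \<le> norm (1 + (norm (f \<omega>))\<^sup>2)"
    by (intro AE_I2)
qed (rule assms(1))

text \<open>
  Expanding the form gives a term linear in \<open>w\<close>, whose expectation factors and vanishes, and a term in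
  \<open>w\<^sup>2\<close>, whose expectation factors with \<open>1\<close>. Independence is required only of real functions of \<open>v\<close>,
  because both members of an independent pair have the same type.
\<close>

lemma (in prob_space) second_moment_step:
  fixes v :: "'a \<Rightarrow> real^'p" and w :: "'a \<Rightarrow> real" and A C :: "real^'p^'q"
  assumes v_meas: "v \<in> borel_measurable M"
    and indep: "\<And>q :: real^'p \<Rightarrow> real. q \<in> borel_measurable borel \<Longrightarrow> indep_var borel (\<lambda>\<omega>. q (v \<omega>)) borel w"
    and w: "integrable M w" "integrable M (\<lambda>\<omega>. (w \<omega>)\<^sup>2)" "expectation w = 0"
      "expectation (\<lambda>\<omega>. (w \<omega>)\<^sup>2) = 1"
    and v: "integrable M (\<lambda>\<omega>. (norm (v \<omega>))\<^sup>2)"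
  shows "integrable M (\<lambda>\<omega>. (norm (A *v v \<omega> + w \<omega> *\<^sub>R (C *v v \<omega>)))\<^sup>2)"
    and "X \<in> sym_mats \<Longrightarrow> expectation (\<lambda>\<omega>. qform X (A *v v \<omega> + w \<omega> *\<^sub>R (C *v v \<omega>))) =
      expectation (\<lambda>\<omega>. qform X (A *v v \<omega>)) + expectation (\<lambda>\<omega>. qform X (C *v v \<omega>))"
proof -
  note int_q = integrable_qform[OF v_meas v]
  have indep1: "indep_var borel (\<lambda>\<omega>. qform S (v \<omega>)) borel w" for S
    by (intro indep borel_measurable_qform) simp
  have indep2: "indep_var borel (\<lambda>\<omega>. qform S (v \<omega>)) borel (\<lambda>\<omega>. (w \<omega>)\<^sup>2)" for S
    using indep_var_compose[OF indep1, of "\<lambda>x. x" borel "\<lambda>x. x\<^sup>2" borel] by (simp add: o_def)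
  have expand: "qform X (A *v x + t *\<^sub>R (C *v x)) = qform (transpose A ** X ** A) x
      + 2 * (qform (transpose A ** X ** C) x * t) + qform (transpose C ** X ** C) x * t\<^sup>2"
    if "X \<in> sym_mats" for X x t
  proof -
    have "(A *v x) \<bullet> (X *v (C *v x)) = qform (transpose A ** X ** C) x"
    proof -
      have "(transpose A ** X ** C) *v x = transpose A *v (X *v (C *v x))"
        by (simp add: matrix_vector_mul_assoc matrix_mul_assoc del: transpose_matrix_vector)
      then show ?thesis
        using inner_transpose_mult[of A "X *v (C *v x)" x]
        by (simp add: qform_def inner_commute del: transpose_matrix_vector)
    qed
    then show ?thesis
      by (simp add: qform_add_vec[OF that] qform_scale_vec qform_congruence matrix_vector_mult_scaleR)
  qed
  note int1 = indep_var_integrable[OF indep1 int_q w(1)]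
  note int2 = indep_var_integrable[OF indep2 int_q w(2)]
  have "(norm y)\<^sup>2 = qform (mat 1) y" for y :: "real^'q" by (simp add: dot_square_norm)
  then show "integrable M (\<lambda>\<omega>. (norm (A *v v \<omega> + w \<omega> *\<^sub>R (C *v v \<omega>)))\<^sup>2)"
    using int1 int2 int_q by (simp only: expand[OF sym_mats_intros(6)]) simp
  assume X: "X \<in> sym_mats"
  have lin: "expectation (\<lambda>\<omega>. qform S (v \<omega>) * w \<omega>) = 0" for S
    using indep_var_lebesgue_integral[OF indep1 int_q w(1)] w(3) by simp
  have quad: "expectation (\<lambda>\<omega>. qform S (v \<omega>) * (w \<omega>)\<^sup>2) = expectation (\<lambda>\<omega>. qform S (v \<omega>))" for S
    using indep_var_lebesgue_integral[OF indep2 int_q w(2)] w(4) by simp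
  have "expectation (\<lambda>\<omega>. qform X (A *v v \<omega> + w \<omega> *\<^sub>R (C *v v \<omega>))) =
      expectation (\<lambda>\<omega>. qform (transpose A ** X ** A) (v \<omega>)) +
      expectation (\<lambda>\<omega>. qform (transpose C ** X ** C) (v \<omega>))"
    unfolding expand[OF X] using int1 int2 int_q by (simp add: lin quad)
  then show "expectation (\<lambda>\<omega>. qform X (A *v v \<omega> + w \<omega> *\<^sub>R (C *v v \<omega>))) =
      expectation (\<lambda>\<omega>. qform X (A *v v \<omega>)) + expectation (\<lambda>\<omega>. qform X (C *v v \<omega>))"
    by (simp add: qform_congruence)
qed

lemma (in prob_space) expectation_noise_scaled:
  fixes v :: "'a \<Rightarrow> real^'p" and w :: "'a \<Rightarrow> real" and C :: "real^'p^'q"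
  assumes indep: "\<And>q :: real^'p \<Rightarrow> real. q \<in> borel_measurable borel \<Longrightarrow> indep_var borel (\<lambda>\<omega>. q (v \<omega>)) borel w"
    and w: "integrable M w" "expectation w = 0" and v: "integrable M v"
  shows "integrable M (\<lambda>\<omega>. w \<omega> *\<^sub>R (C *v v \<omega>))" "expectation (\<lambda>\<omega>. w \<omega> *\<^sub>R (C *v v \<omega>)) = 0"
proof -
  have Cv: "integrable M (\<lambda>\<omega>. (C *v v \<omega>) $ i)" for i
    using v by (intro integrable_bounded_linear[OF bounded_linear_vec_nth]
        integrable_bounded_linear[OF matrix_vector_mul_bounded_linear])
  have indep_i: "indep_var borel (\<lambda>\<omega>. (C *v v \<omega>) $ i) borel w" for i
  proof -
    have "(\<lambda>x. (C *v x) $ i) \<in> borel_measurable borel"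
      by (intro borel_measurable_continuous_onI continuous_intros
          linear_continuous_on[OF matrix_vector_mul_bounded_linear])
    then show ?thesis by (rule indep)
  qed
  have int_i: "integrable M (\<lambda>\<omega>. (C *v v \<omega>) $ i * w \<omega>)" for i
    by (rule indep_var_integrable[OF indep_i Cv w(1)])
  have int_axis: "integrable M (\<lambda>\<omega>. ((C *v v \<omega>) $ i * w \<omega>) *\<^sub>R (axis i 1 :: real^'q))" for i
    using int_i by (rule integrable_scaleR_left)
  have sum_axis: "w \<omega> *\<^sub>R (C *v v \<omega>) = (\<Sum>i\<in>UNIV. ((C *v v \<omega>) $ i * w \<omega>) *\<^sub>R (axis i 1 :: real^'q))" for \<omega>
    by (simp add: vec_eq_iff axis_def if_distrib cong: if_cong)
  show "integrable M (\<lambda>\<omega>. w \<omega> *\<^sub>R (C *v v \<omega>))"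
    unfolding sum_axis using int_axis by simp
  show "expectation (\<lambda>\<omega>. w \<omega> *\<^sub>R (C *v v \<omega>)) = 0"
    unfolding sum_axis using int_axis int_i indep_var_lebesgue_integral[OF indep_i Cv w(1)] w(2)
    by (simp add: integral_scaleR_left)
qed

lemma noise_moments:
  assumes "prob_space M" "noise M w"
  shows "prob_space.indep_vars M (\<lambda>_. borel) w UNIV" "integrable M (w k)"
    "integrable M (\<lambda>\<omega>. (w k \<omega>)\<^sup>2)" "(\<integral>\<omega>. w k \<omega> \<partial>M) = 0" "(\<integral>\<omega>. (w k \<omega>)\<^sup>2 \<partial>M) = 1"
proof -
  have var: "(\<integral>\<omega>. (w k \<omega> - (\<integral>\<eta>. w k \<eta> \<partial>M))\<^sup>2 \<partial>M) = 1" and mean: "(\<integral>\<omega>. w k \<omega> \<partial>M) = 0"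
    using assms(2) unfolding noise_def by blast+
  show "(\<integral>\<omega>. (w k \<omega>)\<^sup>2 \<partial>M) = 1" using var unfolding mean by simp
qed (use assms(2) in \<open>auto simp: noise_def\<close>)

section \<open>Second moments of the closed loop\<close>

text \<open>
  The mean stacked on the deviation from the mean; in these coordinates the closed loop is a linear
  recursion with multiplicative noise.
\<close>

definition split_state :: "'w measure \<Rightarrow> (nat \<Rightarrow> 'w \<Rightarrow> real) \<Rightarrow> ('n::finite, 'm::finite) mf_system \<Rightarrow>
    real^'n^'m \<Rightarrow> real^'n^'m \<Rightarrow> ('w \<Rightarrow> real^'n) \<Rightarrow> nat \<Rightarrow> 'w \<Rightarrow> real^('n + 'n)" where
  "split_state M w sys F Fbar z k \<omega> =
     (let x = closed_loop M w sys F Fbar z k; m = (\<integral>\<eta>. x \<eta> \<partial>M) in vec_append m (x \<omega> - m))"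

lemma mf_step_feedback:
  fixes sys :: "('n::finite, 'm::finite) mf_system"
  assumes "prob_space M" and x: "integrable M x"
    and m: "m = (\<integral>\<eta>. x \<eta> \<partial>M)"
  shows "mf_step M sys x (\<lambda>\<omega>. F *v x \<omega> + Fbar *v m) w \<omega> =
    ((A1hat sys + B1hat sys ** (F + Fbar)) *v m + (A1 sys + B1 sys ** F) *v (x \<omega> - m))
    + w \<omega> *\<^sub>R ((A2hat sys + B2hat sys ** (F + Fbar)) *v m + (A2 sys + B2 sys ** F) *v (x \<omega> - m))"
proof -
  interpret prob_space M by fact
  have "(\<integral>\<eta>. F *v x \<eta> + Fbar *v m \<partial>M) = F *v m + Fbar *v m"
  proof -
    have "integrable M (\<lambda>\<eta>. F *v x \<eta>)" "(\<integral>\<eta>. F *v x \<eta> \<partial>M) = F *v m"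
      using integrable_bounded_linear[OF matrix_vector_mul_bounded_linear x]
        integral_bounded_linear[OF matrix_vector_mul_bounded_linear x] by (simp_all add: m)
    then show ?thesis by (simp add: prob_space)
  qed
  then show ?thesis
    by (simp add: mf_step_def Let_def m[symmetric] A1hat_def A2hat_def B1hat_def B2hat_def
        matrix_vector_mult_add_rdistrib matrix_vector_right_distrib matrix_vector_mult_diff_distrib
        matrix_mul_simps flip: matrix_vector_mul_assoc)
qed

lemma split_state_Suc:
  fixes sys :: "('n::finite, 'm::finite) mf_system"
  assumes M: "prob_space M" and noise: "noise M w" and z: "initial_state M w z"
    and sq: "integrable M (\<lambda>\<omega>. (norm (closed_loop M w sys F Fbar z k \<omega>))\<^sup>2)"
  shows "split_state M w sys F Fbar z (Suc k) \<omega> =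
    cal_A1 sys F Fbar *v split_state M w sys F Fbar z k \<omega>
    + w k \<omega> *\<^sub>R ((cal_A2 sys F + cal_A3 sys F Fbar) *v split_state M w sys F Fbar z k \<omega>)"
proof -
  interpret prob_space M by fact
  note w = noise_moments[OF M noise]
  define x where "x = closed_loop M w sys F Fbar z k"
  define m where "m = expectation x"
  let ?\<alpha> = "A1hat sys + B1hat sys ** (F + Fbar)" and ?\<beta> = "A1 sys + B1 sys ** F"
    and ?\<gamma> = "A2hat sys + B2hat sys ** (F + Fbar)" and ?\<kappa> = "A2 sys + B2 sys ** F"
  have past: "x \<in> borel_measurable (past z w k)"
    unfolding x_def by (rule closed_loop_past_measurable[OF M])
  have indep: "indep_var borel (\<lambda>\<omega>. q (x \<omega>)) borel (w k)" if "q \<in> borel_measurable borel" for q :: "real^'n \<Rightarrow> real"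
    by (rule indep_past_noise[OF w(1) z measurable_compose[OF past that]])
  have x_meas: "x \<in> borel_measurable M"
    unfolding x_def by (rule borel_measurable_closed_loop[OF M noise z])
  have int: "integrable M x"
    by (rule integrable_of_square[OF x_meas sq[folded x_def]])
  have y: "integrable M (\<lambda>\<omega>. x \<omega> - m)" "expectation (\<lambda>\<omega>. x \<omega> - m) = 0"
    using int by (simp_all add: m_def prob_space)
  note bl = matrix_vector_mul_bounded_linear
  have Suc: "closed_loop M w sys F Fbar z (Suc k) \<omega> =
    (?\<alpha> *v m + ?\<beta> *v (x \<omega> - m)) + (w k \<omega> *\<^sub>R (?\<gamma> *v m) + w k \<omega> *\<^sub>R (?\<kappa> *v (x \<omega> - m)))" for \<omega>
    using mf_step_feedback[OF M int m_def, of sys F Fbar "w k" \<omega>]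
    by (simp add: Let_def scaleR_add_right flip: x_def m_def)
  have indep_y: "indep_var borel (\<lambda>\<omega>. q (x \<omega> - m)) borel (w k)"
    if "q \<in> borel_measurable borel" for q :: "real^'n \<Rightarrow> real"
    using indep[of "\<lambda>x. q (x - m)"] that by simp
  note wy = expectation_noise_scaled[OF indep_y w(2,4) y(1), of ?\<kappa>]
  have \<beta>y: "integrable M (\<lambda>\<omega>. ?\<beta> *v (x \<omega> - m))" "expectation (\<lambda>\<omega>. ?\<beta> *v (x \<omega> - m)) = 0"
    using integrable_bounded_linear[OF bl y(1)] integral_bounded_linear[OF bl y(1)] y(2) by simp_all
  have wm: "integrable M (\<lambda>\<omega>. w k \<omega> *\<^sub>R (?\<gamma> *v m))" "expectation (\<lambda>\<omega>. w k \<omega> *\<^sub>R (?\<gamma> *v m)) = 0"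
    using w(2,4) by simp_all
  have mean: "expectation (closed_loop M w sys F Fbar z (Suc k)) = ?\<alpha> *v m"
    unfolding Suc[abs_def] using wy \<beta>y wm by (simp add: prob_space)
  have "split_state M w sys F Fbar z (Suc k) \<omega> =
      vec_append (?\<alpha> *v m) (?\<beta> *v (x \<omega> - m) + (w k \<omega> *\<^sub>R (?\<gamma> *v m) + w k \<omega> *\<^sub>R (?\<kappa> *v (x \<omega> - m))))"
    unfolding split_state_def Let_def mean Suc by simp
  moreover have "split_state M w sys F Fbar z k \<omega> = vec_append m (x \<omega> - m)"
    by (simp add: split_state_def Let_def x_def m_def)
  moreover have "c *\<^sub>R vec_append p q = vec_append (c *\<^sub>R p) (c *\<^sub>R q)" for c and p q :: "real^'n"
    by (simp add: vec_eq_iff all_sum_type)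
  ultimately show ?thesis
    by (simp add: cal_A1_def cal_A2_def cal_A3_def block_diag_def block_mat_add block_mat_vec_append
        vec_append_add scaleR_add_right)
qed

lemma norm_vec_append_sq: "(norm (vec_append (x :: real^'p) (y :: real^'q)))\<^sup>2 = (norm x)\<^sup>2 + (norm y)\<^sup>2"
  by (simp add: power2_norm_eq_inner inner_vec_append)

lemma measurable_split_state:
  assumes M: "prob_space M"
  shows "split_state M w sys F Fbar z k \<in> borel_measurable (prob_space.past M z w k)"
proof -
  have "continuous_on UNIV (\<lambda>x. vec_append m (x - m :: real^'p))" for m :: "real^'p"
  proof -
    have "bounded_linear (\<lambda>x. vec_append 0 x :: real^('p + 'p))"
      unfolding linear_conv_bounded_linear[symmetric]
      by (rule linearI) (simp_all add: vec_eq_iff all_sum_type)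
    then have "continuous_on UNIV (\<lambda>x. vec_append m (- m) + (vec_append 0 x :: real^('p + 'p)))"
      by (intro continuous_intros linear_continuous_on)
    then show ?thesis by (simp add: vec_append_add)
  qed
  from measurable_compose[OF closed_loop_past_measurable[OF M] borel_measurable_continuous_onI[OF this]]
  show ?thesis unfolding split_state_def Let_def .
qed

text \<open>
  The two noisy parts add up before the form is taken, but the operator contains no mixed term: the
  mixed term is linear in the deviation, since the mean is deterministic, and so has expectation \<open>0\<close>.
\<close>

lemma split_state_step:
  fixes sys :: "('n::finite, 'm::finite) mf_system"
  assumes M: "prob_space M" and noise: "noise M w" and z: "initial_state M w z"
    and sq: "integrable M (\<lambda>\<omega>. (norm (split_state M w sys F Fbar z k \<omega>))\<^sup>2)"
      "integrable M (\<lambda>\<omega>. (norm (closed_loop M w sys F Fbar z k \<omega>))\<^sup>2)"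
  shows "integrable M (\<lambda>\<omega>. (norm (split_state M w sys F Fbar z (Suc k) \<omega>))\<^sup>2)"
    and "X \<in> sym_mats \<Longrightarrow> (\<integral>\<omega>. qform X (split_state M w sys F Fbar z (Suc k) \<omega>) \<partial>M) =
      (\<integral>\<omega>. qform (closed_loop_map sys F Fbar X) (split_state M w sys F Fbar z k \<omega>) \<partial>M)"
proof -
  interpret prob_space M by fact
  note w = noise_moments[OF M noise]
  let ?v = "split_state M w sys F Fbar z k"
  let ?A = "cal_A1 sys F Fbar" and ?B = "cal_A2 sys F" and ?C = "cal_A3 sys F Fbar"
  have v_past: "?v \<in> borel_measurable (past z w k)" by (rule measurable_split_state[OF M])
  have indep: "indep_var borel (\<lambda>\<omega>. q (?v \<omega>)) borel (w k)"
    if "q \<in> borel_measurable borel" for q :: "real^('n + 'n) \<Rightarrow> real"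
    by (rule indep_past_noise[OF w(1) z measurable_compose[OF v_past that]])
  have v_meas: "?v \<in> borel_measurable M"
    by (rule measurable_past_imp_measurable[OF w(1) z v_past])
  note step = second_moment_step[OF v_meas indep w(2,3,4,5) sq(1)]
  note Suc = split_state_Suc[OF M noise z sq(2)]
  show "integrable M (\<lambda>\<omega>. (norm (split_state M w sys F Fbar z (Suc k) \<omega>))\<^sup>2)"
    unfolding Suc by (rule step(1))
  assume X: "X \<in> sym_mats"
  define x where "x = closed_loop M w sys F Fbar z k"
  define m where "m = expectation x"
  have x_meas: "x \<in> borel_measurable M"
    unfolding x_def by (rule borel_measurable_closed_loop[OF M noise z])
  have x_int: "integrable M x"
    by (rule integrable_of_square[OF x_meas sq(2)[folded x_def]])
  have v: "?v \<omega> = vec_append m (x \<omega> - m)" for \<omega>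
    by (simp add: split_state_def Let_def x_def m_def)
  let ?\<gamma> = "A2hat sys + B2hat sys ** (F + Fbar)" and ?\<kappa> = "A2 sys + B2 sys ** F"
  define p where "p = X *v vec_append 0 (?\<gamma> *v m)"
  have bl: "bounded_linear (\<lambda>y. vec_append 0 (?\<kappa> *v y) \<bullet> p)"
  proof -
    obtain p1 p2 where "p = vec_append p1 p2" by (rule vec_append_cases)
    then show ?thesis
      unfolding linear_conv_bounded_linear[symmetric]
      by (intro linearI) (simp_all add: inner_vec_append matrix_vector_right_distrib
          matrix_vector_mult_scaleR inner_add_left)
  qed
  have cross: "(?B *v ?v \<omega>) \<bullet> (X *v (?C *v ?v \<omega>)) = vec_append 0 (?\<kappa> *v (x \<omega> - m)) \<bullet> p" for \<omega>
    by (simp add: v p_def cal_A2_def cal_A3_def block_diag_def block_mat_vec_append)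
  have y: "integrable M (\<lambda>\<omega>. x \<omega> - m)" "expectation (\<lambda>\<omega>. x \<omega> - m) = 0"
    using x_int by (simp_all add: m_def prob_space)
  have cross_int: "integrable M (\<lambda>\<omega>. (?B *v ?v \<omega>) \<bullet> (X *v (?C *v ?v \<omega>)))"
    and cross_0: "expectation (\<lambda>\<omega>. (?B *v ?v \<omega>) \<bullet> (X *v (?C *v ?v \<omega>))) = 0"
    unfolding cross using integrable_bounded_linear[OF bl y(1)] integral_bounded_linear[OF bl y(1)] y(2)
    by (simp_all add: vec_append_zero)
  have int: "integrable M (\<lambda>\<omega>. qform X (D *v ?v \<omega>))" for D :: "real^('n + 'n)^('n + 'n)"
    using integrable_qform[OF v_meas sq(1), of "transpose D ** X ** D"]
    by (simp add: qform_congruence)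
  have step2: "expectation (\<lambda>\<omega>. qform X (?A *v ?v \<omega> + w k \<omega> *\<^sub>R ((?B + ?C) *v ?v \<omega>))) =
      expectation (\<lambda>\<omega>. qform X (?A *v ?v \<omega>)) + expectation (\<lambda>\<omega>. qform X ((?B + ?C) *v ?v \<omega>))"
    by (rule step(2)[OF _ X])
  have "expectation (\<lambda>\<omega>. qform X ((?B + ?C) *v ?v \<omega>)) =
      expectation (\<lambda>\<omega>. qform X (?B *v ?v \<omega>)) + expectation (\<lambda>\<omega>. qform X (?C *v ?v \<omega>))"
    unfolding matrix_vector_mult_add_rdistrib qform_add_vec[OF X]
    using int cross_int cross_0 by simp
  then show "expectation (\<lambda>\<omega>. qform X (split_state M w sys F Fbar z (Suc k) \<omega>)) =
      expectation (\<lambda>\<omega>. qform (closed_loop_map sys F Fbar X) (?v \<omega>))"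
    unfolding Suc step2 closed_loop_map_def qform_cong3 using int by simp
qed

text \<open>
  Norms of the state and of the split state are comparable, so square integrability can be propagated
  by the recursion for the split state.
\<close>

lemma square_integrable_closed_loop:
  fixes sys :: "('n::finite, 'm::finite) mf_system"
  assumes M: "prob_space M" and noise: "noise M w" and z: "initial_state M w z"
  shows "integrable M (\<lambda>\<omega>. (norm (closed_loop M w sys F Fbar z k \<omega>))\<^sup>2)"
    and "integrable M (\<lambda>\<omega>. (norm (split_state M w sys F Fbar z k \<omega>))\<^sup>2)"
    and "(\<integral>\<omega>. (norm (split_state M w sys F Fbar z k \<omega>))\<^sup>2 \<partial>M) =
      (\<integral>\<omega>. (norm (closed_loop M w sys F Fbar z k \<omega>))\<^sup>2 \<partial>M)"
proof -
  interpret prob_space M by fact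
  let ?x = "closed_loop M w sys F Fbar z"
  let ?v = "split_state M w sys F Fbar z"
  have meas: "?x k \<in> borel_measurable M" for k
    by (rule borel_measurable_closed_loop[OF M noise z])
  have split: "integrable M (\<lambda>\<omega>. (norm (?v k \<omega>))\<^sup>2)"
    "expectation (\<lambda>\<omega>. (norm (?v k \<omega>))\<^sup>2) = expectation (\<lambda>\<omega>. (norm (?x k \<omega>))\<^sup>2)"
    if sq: "integrable M (\<lambda>\<omega>. (norm (?x k \<omega>))\<^sup>2)" for k
  proof -
    define m where "m = expectation (?x k)"
    have int: "integrable M (?x k)" by (rule integrable_of_square[OF meas sq])
    have eq: "(norm (?v k \<omega>))\<^sup>2 = (norm (?x k \<omega>))\<^sup>2 + 2 * (m \<bullet> m - ?x k \<omega> \<bullet> m)" for \<omega>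
      by (simp add: split_state_def Let_def norm_vec_append_sq flip: m_def)
         (simp add: power2_norm_eq_inner inner_diff_left inner_diff_right inner_commute)
    have inner: "integrable M (\<lambda>\<omega>. ?x k \<omega> \<bullet> m)" "expectation (\<lambda>\<omega>. ?x k \<omega> \<bullet> m) = m \<bullet> m"
      using int by (simp_all add: m_def)
    show "integrable M (\<lambda>\<omega>. (norm (?v k \<omega>))\<^sup>2)"
      "expectation (\<lambda>\<omega>. (norm (?v k \<omega>))\<^sup>2) = expectation (\<lambda>\<omega>. (norm (?x k \<omega>))\<^sup>2)"
      unfolding eq using sq inner by (simp_all add: prob_space)
  qed
  have sq: "integrable M (\<lambda>\<omega>. (norm (?x k \<omega>))\<^sup>2)" for k
  proof (induction k)
    case 0
    then show ?case using z by (simp add: initial_state_def)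
  next
    case (Suc k)
    note v_Suc = split_state_step(1)[OF M noise z split(1)[OF Suc] Suc]
    show ?case
    proof (rule Bochner_Integration.integrable_bound)
      show "integrable M (\<lambda>\<omega>. 2 * (norm (?v (Suc k) \<omega>))\<^sup>2)" using v_Suc by simp
      have "norm ((norm (?x (Suc k) \<omega>))\<^sup>2) \<le> norm (2 * (norm (?v (Suc k) \<omega>))\<^sup>2)" for \<omega>
      proof -
        define a b where "a = expectation (?x (Suc k))" and "b = ?x (Suc k) \<omega> - a"
        have "?x (Suc k) \<omega> = a + b" by (simp add: b_def)
        moreover have "(norm (?v (Suc k) \<omega>))\<^sup>2 = (norm a)\<^sup>2 + (norm b)\<^sup>2"
          by (simp add: split_state_def Let_def norm_vec_append_sq a_def b_def
              del: closed_loop.simps)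
        moreover have "(norm (a + b))\<^sup>2 \<le> 2 * ((norm a)\<^sup>2 + (norm b)\<^sup>2)"
          using inner_ge_zero[of "a - b"]
          by (simp add: power2_norm_eq_inner inner_diff_left inner_diff_right inner_add_left
              inner_add_right inner_commute)
        ultimately show ?thesis by simp
      qed
      then show "AE \<omega> in M. norm ((norm (?x (Suc k) \<omega>))\<^sup>2) \<le> norm (2 * (norm (?v (Suc k) \<omega>))\<^sup>2)"
        by (intro AE_I2)
    qed (use meas[of "Suc k"] in \<open>simp del: closed_loop.simps\<close>)
  qed
  show "integrable M (\<lambda>\<omega>. (norm (?x k \<omega>))\<^sup>2)" by (rule sq)
  show "integrable M (\<lambda>\<omega>. (norm (?v k \<omega>))\<^sup>2)"
    "expectation (\<lambda>\<omega>. (norm (?v k \<omega>))\<^sup>2) = expectation (\<lambda>\<omega>. (norm (?x k \<omega>))\<^sup>2)"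
    using split[OF sq] by simp_all
qed

lemma second_moment_closed_loop:
  assumes M: "prob_space M" and noise: "noise M w" and z: "initial_state M w z"
  shows "(\<integral>\<omega>. (norm (closed_loop M w sys F Fbar z k \<omega>))\<^sup>2 \<partial>M) =
    (\<integral>\<omega>. qform ((closed_loop_map sys F Fbar ^^ k) (mat 1)) (split_state M w sys F Fbar z 0 \<omega>) \<partial>M)"
proof -
  let ?L = "closed_loop_map sys F Fbar"
  let ?E = "\<lambda>k X. \<integral>\<omega>. qform X (split_state M w sys F Fbar z k \<omega>) \<partial>M"
  have "?E k X = ?E 0 ((?L ^^ k) X)" if "X \<in> sym_mats" for X
    using that
  proof (induction k arbitrary: X)
    case (Suc k)
    have "?E (Suc k) X = ?E k (?L X)"
      by (rule split_state_step(2)[OF M noise z square_integrable_closed_loop(2,1)[OF M noise z] Suc.prems])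
    also have "\<dots> = ?E 0 ((?L ^^ k) (?L X))"
      by (rule Suc.IH[OF positive_map_sym[OF positive_map_loops(1) Suc.prems]])
    also have "(?L ^^ k) (?L X) = (?L ^^ Suc k) X" by (simp add: funpow_swap1)
    finally show ?case .
  qed simp
  from this[OF sym_mats_intros(6)] show ?thesis
    by (simp add: square_integrable_closed_loop(3)[OF M noise z, symmetric] dot_square_norm)
qed

text \<open>
  A block diagonal \<open>Y\<close> does not couple the mean and the deviation, so only the diagonal blocks of the
  second moment of the split state enter: the outer square of the mean and the covariance.
\<close>

lemma initial_second_moment:
  assumes M: "prob_space M" and z: "initial_state M w z"
    and Y: "block_diagonal Y" "Y \<in> sym_mats"
  shows "(\<integral>\<omega>. qform Y (split_state M w sys F Fbar z 0 \<omega>) \<partial>M) =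
    trace (block_diag (outer_prod (\<integral>\<omega>. z \<omega> \<partial>M) (\<integral>\<omega>. z \<omega> \<partial>M))
      ((\<integral>\<omega>. outer_prod (z \<omega>) (z \<omega>) \<partial>M) - outer_prod (\<integral>\<omega>. z \<omega> \<partial>M) (\<integral>\<omega>. z \<omega> \<partial>M)) ** Y)"
proof -
  interpret prob_space M by fact
  define m where "m = expectation z"
  obtain P D where PD: "Y = block_diag P D" using Y(1) by (auto simp: block_diagonal_def)
  have D: "D \<in> sym_mats" using Y(2) by (simp add: PD block_diag_sym)
  have z_meas: "z \<in> borel_measurable M" and z_sq: "integrable M (\<lambda>\<omega>. (norm (z \<omega>))\<^sup>2)"
    using z by (simp_all add: initial_state_def)
  have z_int: "integrable M z" by (rule integrable_of_square[OF z_meas z_sq])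
  have cont: "continuous_on UNIV (\<lambda>x. outer_prod x x :: real^'p^'p)"
    unfolding outer_prod_def by (intro continuous_intros)
  have outer_int: "integrable M (\<lambda>\<omega>. outer_prod (z \<omega>) (z \<omega>))"
  proof (rule Bochner_Integration.integrable_bound[OF z_sq])
    show "(\<lambda>\<omega>. outer_prod (z \<omega>) (z \<omega>)) \<in> borel_measurable M"
      by (rule measurable_compose[OF z_meas borel_measurable_continuous_onI[OF cont]])
    have "norm (outer_prod x x) \<le> norm ((norm x)\<^sup>2)" for x :: "real^'p"
    proof -
      have "outer_prod x x $ i = (x $ i) *\<^sub>R x" for i
        by (simp add: outer_prod_def vec_eq_iff)
      then have "(norm (outer_prod x x))\<^sup>2 = (\<Sum>i\<in>UNIV. (x $ i)\<^sup>2 * (norm x)\<^sup>2)"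
        by (simp add: norm_vec_def[of "outer_prod x x"] L2_set_def sum_nonneg power_mult_distrib)
      also have "\<dots> = (x \<bullet> x) * (norm x)\<^sup>2"
        by (simp add: inner_vec_def power2_eq_square sum_distrib_right)
      also have "\<dots> = ((norm x)\<^sup>2)\<^sup>2" by (simp add: dot_square_norm power2_eq_square)
      finally have "norm (outer_prod x x) = (norm x)\<^sup>2"
        by (rule power2_eq_imp_eq) simp_all
      then show ?thesis by simp
    qed
    then show "AE \<omega> in M. norm (outer_prod (z \<omega>) (z \<omega>)) \<le> norm ((norm (z \<omega>))\<^sup>2)"
      by (intro AE_I2)
  qed
  have bl: "bounded_linear (\<lambda>S. trace (S ** D))"
    unfolding linear_conv_bounded_linear[symmetric]
    by (rule linearI) (simp_all add: matrix_mul_simps matrix_scaleR_simps trace_add trace_scaleR)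
  have zD: "integrable M (\<lambda>\<omega>. qform D (z \<omega>))"
    "expectation (\<lambda>\<omega>. qform D (z \<omega>)) = trace (expectation (\<lambda>\<omega>. outer_prod (z \<omega>) (z \<omega>)) ** D)"
    using integrable_bounded_linear[OF bl outer_int] integral_bounded_linear[OF bl outer_int]
    by (simp_all add: trace_outer_prod_mult)
  have expand: "qform Y (split_state M w sys F Fbar z 0 \<omega>) =
      qform P m + (qform D (z \<omega>) - 2 * (z \<omega> \<bullet> (D *v m)) + qform D m)" for \<omega>
  proof -
    have "qform D (z \<omega> + (-1) *\<^sub>R m) = qform D (z \<omega>) + 2 * (z \<omega> \<bullet> (D *v ((-1) *\<^sub>R m))) + qform D ((-1) *\<^sub>R m)"
      by (rule qform_add_vec[OF D])
    then show ?thesis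
      unfolding matrix_vector_mult_scaleR qform_scale_vec
      by (simp add: split_state_def Let_def PD qform_block_diag flip: m_def)
  qed
  have inner: "integrable M (\<lambda>\<omega>. z \<omega> \<bullet> (D *v m))" "expectation (\<lambda>\<omega>. z \<omega> \<bullet> (D *v m)) = qform D m"
    using z_int by (simp_all add: m_def qform_def)
  have "expectation (\<lambda>\<omega>. qform Y (split_state M w sys F Fbar z 0 \<omega>)) =
      qform P m + (trace (expectation (\<lambda>\<omega>. outer_prod (z \<omega>) (z \<omega>)) ** D) - qform D m)"
    unfolding expand using inner zD by (simp add: prob_space)
  then show ?thesis
    by (simp add: PD trace_block_diag_mult matrix_mul_simps trace_sub trace_outer_prod_mult flip: m_def)
qed

text \<open>
  The decay of the second moments is known only for admissible initial states, and the given ones are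
  used here: their mean squares and covariances add up to the block matrix on the left.
\<close>

lemma stabilizing_imp_decay:
  assumes M: "prob_space M" and noise: "noise M w"
    and stab: "\<And>z. initial_state M w z \<Longrightarrow> ms_to_zero M (closed_loop M w sys F Fbar z)"
    and z: "\<And>l. l \<in> {1..r} \<Longrightarrow> initial_state M w (z l)"
    and Z2: "Z2 = (\<Sum>l=1..r. outer_prod (\<integral>\<omega>. z l \<omega> \<partial>M) (\<integral>\<omega>. z l \<omega> \<partial>M))"
    and Z1: "Z1 = (\<Sum>l=1..r. \<integral>\<omega>. outer_prod (z l \<omega>) (z l \<omega>) \<partial>M)"
  shows "(\<lambda>k. trace (block_diag Z2 (Z1 - Z2) ** (closed_loop_map sys F Fbar ^^ k) (mat 1))) \<longlonglongrightarrow> 0"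
proof -
  let ?L = "closed_loop_map sys F Fbar"
  let ?a = "\<lambda>l. outer_prod (\<integral>\<omega>. z l \<omega> \<partial>M) (\<integral>\<omega>. z l \<omega> \<partial>M)"
  let ?b = "\<lambda>l. \<integral>\<omega>. outer_prod (z l \<omega>) (z l \<omega>) \<partial>M"
  have pow: "block_diagonal ((?L ^^ k) (mat 1))" "(?L ^^ k) (mat 1) \<in> sym_mats" for k
    by (induction k) (auto simp: closed_loop_map_eq intro: block_diagonal_intros
        positive_map_sym[OF positive_map_loops(1), of _ sys F Fbar, unfolded closed_loop_map_eq])
  have sum: "trace (block_diag Z2 (Z1 - Z2) ** Y) = (\<Sum>l=1..r. trace (block_diag (?a l) (?b l - ?a l) ** Y))"
    if Y: "block_diagonal Y" for Y
  proof -
    obtain P D where "Y = block_diag P D" using Y by (auto simp: block_diagonal_def)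
    then show ?thesis
      by (simp add: trace_block_diag_mult Z1 Z2 trace_sum_mult sum.distrib flip: sum_subtractf)
  qed
  have "trace (block_diag Z2 (Z1 - Z2) ** (?L ^^ k) (mat 1)) =
      (\<Sum>l=1..r. \<integral>\<omega>. (norm (closed_loop M w sys F Fbar (z l) k \<omega>))\<^sup>2 \<partial>M)" for k
    unfolding sum[OF pow(1)] by (intro sum.cong refl)
      (simp add: second_moment_closed_loop[OF M noise z] initial_second_moment[OF M z pow])
  moreover have "(\<lambda>k. \<Sum>l=1..r. \<integral>\<omega>. (norm (closed_loop M w sys F Fbar (z l) k \<omega>))\<^sup>2 \<partial>M)
      \<longlonglongrightarrow> (\<Sum>l=1..r. 0)"
    using stab[OF z] by (intro tendsto_sum) (simp add: ms_to_zero_def)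
  ultimately show ?thesis by simp
qed

section \<open>Strong duality\<close>

theorem theorem3p1:
  fixes sys :: "('n::finite, 'm::finite) mf_system"
    and Q Qbar :: "real^'n^'n" and R Rbar :: "real^'m^'m"
    and M :: "'w measure" and w :: "nat \<Rightarrow> 'w \<Rightarrow> real"
    and r :: nat and z :: "nat \<Rightarrow> 'w \<Rightarrow> real^'n"
    and Z1 Z2 :: "real^'n^'n"
  assumes "prob_space M" and "noise M w"
    and "Q \<in> sym_mats" and "Qbar \<in> sym_mats" and "R \<in> sym_mats" and "Rbar \<in> sym_mats"
    and "psd Q" and "psd (Q + Qbar)" and "posdef R" and "posdef (R + Rbar)"
    and "stabilizable M w sys"
    and "exactly_observable M w sys Q Qbar \<or> exactly_detectable M w sys Q Qbar"
    and "\<And>l. l \<in> {1..r} \<Longrightarrow> initial_state M w (z l)"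
    and "Z2 = (\<Sum>l=1..r. outer_prod (\<integral>\<omega>. z l \<omega> \<partial>M) (\<integral>\<omega>. z l \<omega> \<partial>M))"
    and "Z1 = (\<Sum>l=1..r. \<integral>\<omega>. outer_prod (z l \<omega>) (z l \<omega>) \<partial>M)"
    and "posdef Z2" and "posdef (Z1 - Z2)"
  shows "dual_value sys Q Qbar R Rbar Z1 Z2 = primal_value sys Q Qbar R Rbar Z1 Z2"
proof -
  note M = assms(1) and noise = assms(2) and Q = assms(7,8) and R = assms(9,10) and z = assms(13)
  let ?W = "weight Q Qbar R Rbar"
  obtain F Fbar where stab: "\<And>z. initial_state M w z \<Longrightarrow> ms_to_zero M (closed_loop M w sys F Fbar z)"
    using assms(11) by (auto simp: stabilizable_def)
  have Z: "posdef (block_diag Z2 (Z1 - Z2))"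
    by (rule posdef_block_diag[OF assms(16,17)])
  have W: "psd ?W" using R by (intro psd_weight Q posdef_imp_psd)
  have decay: "(\<lambda>k. trace (block_diag Z2 (Z1 - Z2) ** (closed_loop_map sys F Fbar ^^ k) (mat 1)))
      \<longlonglongrightarrow> 0"
    by (rule stabilizing_imp_decay[OF M noise stab z assms(14,15)])
  obtain X where X: "supersolution sys ?W F Fbar X"
    by (rule supersolution_of_decay[OF W Z decay])
  show ?thesis
    by (rule strong_duality_of_supersolution[OF Q R posdef_imp_psd[OF Z] X])
qed

end
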